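(* Let $A$ be any $\mathcal{C}^{\infty}$-ring, let $A_{\omega}$ be the colimit of the sequence $A=A_0\to A_1\to A_2\to\cdots$ defined in the context, and let $\nu_0: A=A_0\to A_{\omega}$ be the colimit arrow. Then the pair $(A_{\omega},\nu_0: A\to A_{\omega})$ is the $\mathcal{C}^{\infty}$-von Neumann regular hull of $A$; that is, $A_\omega$ is a von Neumann regular $\mathcal{C}^{\infty}$-ring, and for every von Neumann regular $\mathcal{C}^{\infty}$-ring $V$ and every $\mathcal{C}^{\infty}$-homomorphism $f: A\to V$ there is a unique $\mathcal{C}^{\infty}$-homomorphism $\widetilde{f}: A_{\omega}\to V$ such that $\widetilde{f}\circ\nu_0=f$.
   Context: A $\mathcal{C}^{\infty}$-ring is a set $A$ with an operation $A^n\to A$ for each $n\ge 0$ and each smooth $f:\mathbb{R}^n\to\mathbb{R}$, such that coordinate projections are interpreted as projections and composition of smooth functions is respected; $\mathcal{C}^{\infty}$-homomorphisms are the maps preserving all these operations. Each $\mathcal{C}^{\infty}$-ring has an underlying commutative unital ring; for a ring ideal $I$ the quotient $A/I$ is canonically a $\mathcal{C}^{\infty}$-ring. A $\mathcal{C}^{\infty}$-ring $A$ is von Neumann regular if $(\forall a\in A)(\exists x\in A)(a=a^2x)$. A $\mathcal{C}^{\infty}$-von Neumann regular hull of $A$ is a von Neumann regular $\mathcal{C}^{\infty}$-ring $\mathrm{vN}(A)$ with a $\mathcal{C}^{\infty}$-homomorphism $\nu_A:A\to\mathrm{vN}(A)$ through which every $\mathcal{C}^{\infty}$-homomorphism from $A$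 to a von Neumann regular $\mathcal{C}^{\infty}$-ring factors uniquely. Construction. For a $\mathcal{C}^{\infty}$-ring $B$, let $B\{x_b\mid b\in B\}$ be the coproduct, in the category of $\mathcal{C}^{\infty}$-rings, of $B$ with the free $\mathcal{C}^{\infty}$-ring on the underlying set of $B$ (with free generators $x_b$, $b\in B$). Put $$B^{+}=\frac{B\{x_b\mid b\in B\}}{\langle\{x_b\cdot b\cdot x_b-x_b,\ b\cdot x_b\cdot b-b\mid b\in B\}\rangle},$$ and let $B\to B^{+}$ be the coproduct map $B\to B\{x_b\mid b\in B\}$ followed by the quotient map. Set $A_0=A$, $A_{n+1}=A_n^{+}$, with transition maps $\nu_{n,n+1}:A_n\to A_n^{+}=A_{n+1}$ the maps just described, and $A_{\omega}=\varinjlim_{n\in\mathbb{N}}A_n$ in the category of $\mathcal{C}^{\infty}$-rings. *)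

theory Defs
  imports "HOL-Analysis.Analysis" "HOL-Algebra.QuotRing"
begin

section \<open>Smooth functions\<close>

text \<open>A point of \<open>\<real>\<^sup>n\<close> is a list of length \<open>n\<close>; a function on \<open>\<real>\<^sup>n\<close> is a
  function on lists of which only the values on lists of length \<open>n\<close> matter.
  \<open>Ck n k f\<close>: all iterated partial derivatives of \<open>f\<close> of order at most \<open>k\<close> exist and are
  continuous on \<open>\<real>\<^sup>n\<close>.\<close>

primrec Ck :: "nat \<Rightarrow> nat \<Rightarrow> (real list \<Rightarrow> real) \<Rightarrow> bool" where
  "Ck n 0 f \<longleftrightarrow>
     continuous_map (Euclidean_space n) euclideanreal (\<lambda>x. f (map x [0..<n]))"
| "Ck n (Suc k) f \<longleftrightarrow>
     continuous_map (Euclidean_space n) euclideanreal (\<lambda>x. f (map x [0..<n])) \<and>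
     (\<forall>i<n. \<exists>g. Ck n k g \<and>
        (\<forall>v. length v = n \<longrightarrow>
           ((\<lambda>t. f (v[i := t])) has_real_derivative g v) (at (v ! i))))"

definition smooth :: "nat \<Rightarrow> (real list \<Rightarrow> real) \<Rightarrow> bool" where
  "smooth n f \<longleftrightarrow> (\<forall>k. Ck n k f)"


section \<open>\<open>C\<^sup>\<infinity>\<close>-rings and their homomorphisms\<close>

record 'a cinf = "'a partial_object" +
  opr :: "nat \<Rightarrow> (real list \<Rightarrow> real) \<Rightarrow> 'a list \<Rightarrow> 'a"

text \<open>The axioms force \<open>opr A n f\<close> to depend on the values of \<open>f\<close> on \<open>\<real>\<^sup>n\<close> only: on lists
  \<open>v\<close> of length \<open>n\<close>, \<open>f\<close> agrees with its composite with the \<open>n\<close> projections, and this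
  composite, as a function on all lists, is determined by \<open>f\<close> on lists of length \<open>n\<close>.\<close>

definition cinf_ring :: "'a cinf \<Rightarrow> bool" where
  "cinf_ring A \<longleftrightarrow>
     (\<forall>n f as. smooth n f \<and> length as = n \<and> set as \<subseteq> carrier A \<longrightarrow>
        opr A n f as \<in> carrier A) \<and>
     (\<forall>n i as. i < n \<and> length as = n \<and> set as \<subseteq> carrier A \<longrightarrow>
        opr A n (\<lambda>v. v ! i) as = as ! i) \<and>
     (\<forall>n m f gs as. smooth m f \<and> length gs = m \<and> (\<forall>g\<in>set gs. smooth n g) \<and>
        length as = n \<and> set as \<subseteq> carrier A \<longrightarrow>
        opr A n (\<lambda>v. f (map (\<lambda>g. g v) gs)) as = opr A m f (map (\<lambda>g. opr A n g as) gs))"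

definition cinf_hom :: "'a cinf \<Rightarrow> 'b cinf \<Rightarrow> ('a \<Rightarrow> 'b) set" where
  "cinf_hom A B = {h \<in> carrier A \<rightarrow> carrier B.
     \<forall>n f as. smooth n f \<and> length as = n \<and> set as \<subseteq> carrier A \<longrightarrow>
       h (opr A n f as) = opr B n f (map h as)}"

definition ring_of :: "'a cinf \<Rightarrow> 'a ring" where
  "ring_of A =
     \<lparr>carrier = carrier A,
      mult = (\<lambda>a b. opr A 2 (\<lambda>v. v ! 0 * v ! 1) [a, b]),
      one = opr A 0 (\<lambda>v. 1) [],
      zero = opr A 0 (\<lambda>v. 0) [],
      add = (\<lambda>a b. opr A 2 (\<lambda>v. v ! 0 + v ! 1) [a, b])\<rparr>"

definition vN_regular :: "'a cinf \<Rightarrow> bool" where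
  "vN_regular A \<longleftrightarrow>
     (\<forall>a\<in>carrier A. \<exists>x\<in>carrier A. a = a [^]\<^bsub>ring_of A\<^esub> (2::nat) \<otimes>\<^bsub>ring_of A\<^esub> x)"

text \<open>The test rings \<open>V\<close> live in the type passed as the first argument. Homomorphisms matter
  on the carrier only, hence uniqueness is among the extensional ones.\<close>

definition vN_hull :: "'v itself \<Rightarrow> 'a cinf \<Rightarrow> 'h cinf \<Rightarrow> ('a \<Rightarrow> 'h) \<Rightarrow> bool" where
  "vN_hull _ A H \<nu> \<longleftrightarrow>
     cinf_ring H \<and> vN_regular H \<and> \<nu> \<in> cinf_hom A H \<and>
     (\<forall>(V :: 'v cinf) f. cinf_ring V \<and> vN_regular V \<and> f \<in> cinf_hom A V \<longrightarrow>
        (\<exists>!g. g \<in> cinf_hom H V \<inter> extensional (carrier H) \<and>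
              (\<forall>a\<in>carrier A. g (\<nu> a) = f a)))"


section \<open>Quotients, free rings and coproducts\<close>

text \<open>As in the library's quotient ring, an operation on cosets is the union of the cosets of
  all results on representatives (a single coset, by Hadamard's lemma).\<close>

definition cinf_quot :: "'a cinf \<Rightarrow> 'a set \<Rightarrow> 'a set cinf" where
  "cinf_quot A I =
     \<lparr>carrier = carrier (ring_of A Quot I),
      opr = (\<lambda>n f Xs. \<Union>as\<in>listset Xs. I +>\<^bsub>ring_of A\<^esub> opr A n f as)\<rparr>"

text \<open>The free \<open>C\<^sup>\<infinity>\<close>-ring on \<open>S\<close> is the ring of smooth functions on \<open>\<real>\<^sup>S\<close> depending on
  finitely many coordinates, with pointwise operations; generators are the coordinates.\<close>

definition cinf_free :: "'s set \<Rightarrow> (('s \<Rightarrow> real) \<Rightarrow> real) cinf" where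
  "cinf_free S =
     \<lparr>carrier = {(\<lambda>x. f (map x ss)) | f ss. smooth (length ss) f \<and> set ss \<subseteq> S},
      opr = (\<lambda>n f Fs x. f (map (\<lambda>F. F x) Fs))\<rparr>"

definition free_gen :: "'s \<Rightarrow> ('s \<Rightarrow> real) \<Rightarrow> real" where
  "free_gen s = (\<lambda>x. x s)"

text \<open>The coproduct of \<open>B\<close> and \<open>C\<close>, by generators and relations: the free ring on the disjoint
  union of the underlying sets, modulo the relations that hold in \<open>B\<close> and in \<open>C\<close>.\<close>

definition coprod_rel ::
  "'b cinf \<Rightarrow> 'c cinf \<Rightarrow> (('b + 'c \<Rightarrow> real) \<Rightarrow> real) set" where
  "coprod_rel B C =
     (let F = cinf_free (carrier B <+> carrier C) in
      genideal (ring_of F)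
       ({opr F n f (map (free_gen \<circ> Inl) bs) \<ominus>\<^bsub>ring_of F\<^esub> free_gen (Inl (opr B n f bs)) | n f bs.
           smooth n f \<and> length bs = n \<and> set bs \<subseteq> carrier B} \<union>
        {opr F n f (map (free_gen \<circ> Inr) cs) \<ominus>\<^bsub>ring_of F\<^esub> free_gen (Inr (opr C n f cs)) | n f cs.
           smooth n f \<and> length cs = n \<and> set cs \<subseteq> carrier C}))"

definition cinf_coprod ::
  "'b cinf \<Rightarrow> 'c cinf \<Rightarrow> (('b + 'c \<Rightarrow> real) \<Rightarrow> real) set cinf" where
  "cinf_coprod B C = cinf_quot (cinf_free (carrier B <+> carrier C)) (coprod_rel B C)"

definition coprod_inl ::
  "'b cinf \<Rightarrow> 'c cinf \<Rightarrow> 'b \<Rightarrow> (('b + 'c \<Rightarrow> real) \<Rightarrow> real) set" where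
  "coprod_inl B C b =
     coprod_rel B C +>\<^bsub>ring_of (cinf_free (carrier B <+> carrier C))\<^esub> free_gen (Inl b)"

definition coprod_inr ::
  "'b cinf \<Rightarrow> 'c cinf \<Rightarrow> 'c \<Rightarrow> (('b + 'c \<Rightarrow> real) \<Rightarrow> real) set" where
  "coprod_inr B C c =
     coprod_rel B C +>\<^bsub>ring_of (cinf_free (carrier B <+> carrier C))\<^esub> free_gen (Inr c)"


section \<open>The construction \<open>B\<^sup>+\<close>\<close>

type_synonym 'b adj = "(('b + (('b \<Rightarrow> real) \<Rightarrow> real) \<Rightarrow> real) \<Rightarrow> real) set"

definition adjoin :: "'b cinf \<Rightarrow> 'b adj cinf" where
  "adjoin B = cinf_coprod B (cinf_free (carrier B))"

definition adjoin_map :: "'b cinf \<Rightarrow> 'b \<Rightarrow> 'b adj" where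
  "adjoin_map B = coprod_inl B (cinf_free (carrier B))"

definition adjoin_var :: "'b cinf \<Rightarrow> 'b \<Rightarrow> 'b adj" where
  "adjoin_var B b = coprod_inr B (cinf_free (carrier B)) (free_gen b)"

definition plus_ideal :: "'b cinf \<Rightarrow> 'b adj set" where
  "plus_ideal B =
     (let R = ring_of (adjoin B); \<iota> = adjoin_map B; x = adjoin_var B in
      genideal R
       ({(x b \<otimes>\<^bsub>R\<^esub> \<iota> b \<otimes>\<^bsub>R\<^esub> x b) \<ominus>\<^bsub>R\<^esub> x b | b. b \<in> carrier B} \<union>
        {(\<iota> b \<otimes>\<^bsub>R\<^esub> x b \<otimes>\<^bsub>R\<^esub> \<iota> b) \<ominus>\<^bsub>R\<^esub> \<iota> b | b. b \<in> carrier B}))"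

definition plus_ring :: "'b cinf \<Rightarrow> 'b adj set cinf" where
  "plus_ring B = cinf_quot (adjoin B) (plus_ideal B)"

definition plus_map :: "'b cinf \<Rightarrow> 'b \<Rightarrow> 'b adj set" where
  "plus_map B b = plus_ideal B +>\<^bsub>ring_of (adjoin B)\<^esub> adjoin_map B b"


section \<open>The sequence \<open>A\<^sub>n\<close> and its colimit\<close>

text \<open>The type of \<open>plus_ring B\<close> grows with that of \<open>B\<close>. To have all \<open>A\<^sub>n\<close> in one type, each
  \<open>plus_ring\<close> is replaced by an isomorphic copy, along an injection of its carrier into the
  type below. Such an injection exists because an element of \<open>plus_ring B\<close> is given by
  finitely many smooth functions and elements of \<open>B\<close>.\<close>

datatype 'a univ =
    Base 'a
  | Node "real list \<Rightarrow> real" "('a univ + (real list \<Rightarrow> real) \<times> 'a univ list) list"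

lemma ex_inj_plus_ring:
  fixes B :: "'a univ cinf"
  shows "\<exists>h :: 'a univ adj set \<Rightarrow> 'a univ. inj_on h (carrier (plus_ring B))"
proof -
  let ?F = "cinf_free (carrier B <+> carrier (cinf_free (carrier B)))"
  define dec :: "'a univ + (real list \<Rightarrow> real) \<times> 'a univ list
      \<Rightarrow> 'a univ + (('a univ \<Rightarrow> real) \<Rightarrow> real)"
    where "dec = (\<lambda>s. case s of Inl b \<Rightarrow> Inl b
    | Inr (g, bs) \<Rightarrow> Inr (\<lambda>y. g (map y bs)))"
  define d :: "'a univ \<Rightarrow> 'a univ adj set" where "d = (\<lambda>u. case u of Base _ \<Rightarrow> undefined
    | Node f ss \<Rightarrow> plus_ideal B +>\<^bsub>ring_of (adjoin B)\<^esub>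
        (coprod_rel B (cinf_free (carrier B)) +>\<^bsub>ring_of ?F\<^esub> (\<lambda>x. f (map x (map dec ss)))))"
  have sur: "\<exists>ts. ss = map dec ts"
    if "set ss \<subseteq> carrier B <+> carrier (cinf_free (carrier B))" for ss
    using that
  proof (induction ss)
    case (Cons s ss)
    then obtain ts where ts: "ss = map dec ts" by auto
    have "s \<in> carrier B <+> carrier (cinf_free (carrier B))" using Cons.prems by simp
    then have "\<exists>t. s = dec t"
    proof
      fix b assume "s = Inl b"
      then show ?thesis by (intro exI[of _ "Inl b"]) (simp add: dec_def)
    next
      fix c assume "s = Inr c" and "c \<in> carrier (cinf_free (carrier B))"
      then obtain g bs where "s = Inr (\<lambda>y. g (map y bs))" by (auto simp: cinf_free_def)
      then show ?thesis by (intro exI[of _ "Inr (g, bs)"]) (simp add: dec_def)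
    qed
    then obtain t where "s = dec t" ..
    with ts have "s # ss = map dec (t # ts)" by simp
    then show ?case by (rule exI)
  qed simp
  have "carrier (plus_ring B) \<subseteq> d ` UNIV"
  proof
    fix p assume "p \<in> carrier (plus_ring B)"
    then obtain q where q: "q \<in> carrier (adjoin B)"
      and p: "p = plus_ideal B +>\<^bsub>ring_of (adjoin B)\<^esub> q"
      by (auto simp: plus_ring_def cinf_quot_def FactRing_def A_RCOSETS_def' a_r_coset_def' ring_of_def)
    from q obtain r where r: "r \<in> carrier ?F"
      and q': "q = coprod_rel B (cinf_free (carrier B)) +>\<^bsub>ring_of ?F\<^esub> r"
      by (auto simp: adjoin_def cinf_coprod_def cinf_quot_def FactRing_def A_RCOSETS_def'
          a_r_coset_def' ring_of_def)
    from r obtain f ss where rf: "r = (\<lambda>x. f (map x ss))"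
      and ss: "set ss \<subseteq> carrier B <+> carrier (cinf_free (carrier B))"
      unfolding cinf_free_def[of "carrier B <+> _"] by auto
    from sur[OF ss] obtain ts where "ss = map dec ts" ..
    then have "p = d (Node f ts)" by (simp add: d_def p q' rf)
    then show "p \<in> d ` UNIV" by blast
  qed
  then show ?thesis using inj_on_inv_into by blast
qed

definition embed :: "'a univ cinf \<Rightarrow> 'a univ adj set \<Rightarrow> 'a univ" where
  "embed B = (SOME h. inj_on h (carrier (plus_ring B)))"

lemma inj_on_embed: "inj_on (embed B) (carrier (plus_ring B))"
  unfolding embed_def using ex_inj_plus_ring by (rule someI_ex)

definition cinf_copy :: "('a \<Rightarrow> 'b) \<Rightarrow> 'a cinf \<Rightarrow> 'b cinf" where
  "cinf_copy h A =
     \<lparr>carrier = h ` carrier A,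
      opr = (\<lambda>n f bs. h (opr A n f (map (inv_into (carrier A) h) bs)))\<rparr>"

primrec vN_seq :: "'a cinf \<Rightarrow> nat \<Rightarrow> 'a univ cinf" where
  "vN_seq A 0 = cinf_copy Base A"
| "vN_seq A (Suc n) = cinf_copy (embed (vN_seq A n)) (plus_ring (vN_seq A n))"

definition vN_step :: "'a cinf \<Rightarrow> nat \<Rightarrow> 'a univ \<Rightarrow> 'a univ" where
  "vN_step A n b = embed (vN_seq A n) (plus_map (vN_seq A n) b)"

text \<open>\<open>seq_map t m d\<close> is the composite \<open>A\<^sub>m \<rightarrow> A\<^bsub>m+d\<^esub>\<close> of the transition maps
  \<open>t n : A\<^sub>n \<rightarrow> A\<^bsub>n+1\<^esub>\<close>.\<close>

primrec seq_map :: "(nat \<Rightarrow> 'a \<Rightarrow> 'a) \<Rightarrow> nat \<Rightarrow> nat \<Rightarrow> 'a \<Rightarrow> 'a" where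
  "seq_map t m 0 a = a"
| "seq_map t m (Suc d) a = t (m + d) (seq_map t m d a)"

definition colim_rel ::
  "(nat \<Rightarrow> 'a cinf) \<Rightarrow> (nat \<Rightarrow> 'a \<Rightarrow> 'a) \<Rightarrow> ((nat \<times> 'a) \<times> (nat \<times> 'a)) set" where
  "colim_rel S t = {((m, a), (n, b)) | m a n b.
     a \<in> carrier (S m) \<and> b \<in> carrier (S n) \<and>
     (\<exists>i j. m + i = n + j \<and> seq_map t m i a = seq_map t n j b)}"

definition colim_map ::
  "(nat \<Rightarrow> 'a cinf) \<Rightarrow> (nat \<Rightarrow> 'a \<Rightarrow> 'a) \<Rightarrow> nat \<Rightarrow> 'a \<Rightarrow> (nat \<times> 'a) set" where
  "colim_map S t n a = colim_rel S t `` {(n, a)}"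

text \<open>Operations are computed at any stage \<open>k\<close> where all arguments have representatives; the
  results of all choices are the same class, of which the union is taken.\<close>

definition cinf_colim ::
  "(nat \<Rightarrow> 'a cinf) \<Rightarrow> (nat \<Rightarrow> 'a \<Rightarrow> 'a) \<Rightarrow> (nat \<times> 'a) set cinf" where
  "cinf_colim S t =
     \<lparr>carrier = (SIGMA n:UNIV. carrier (S n)) // colim_rel S t,
      opr = (\<lambda>n f Xs. \<Union>{colim_map S t k (opr (S k) n f as) | k as.
                set as \<subseteq> carrier (S k) \<and> map (colim_map S t k) as = Xs})\<rparr>"

definition A_omega :: "'a cinf \<Rightarrow> (nat \<times> 'a univ) set cinf" where
  "A_omega A = cinf_colim (vN_seq A) (vN_step A)"

definition nu0 :: "'a cinf \<Rightarrow> 'a \<Rightarrow> (nat \<times> 'a univ) set" where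
  "nu0 A a = colim_map (vN_seq A) (vN_step A) 0 (Base a)"

end

theory Submission
  imports Defs
begin

text \<open>In a commutative ring an element \<open>x\<close> with \<open>b x b = b\<close> and \<open>x b x = x\<close> is determined by \<open>b\<close>
(\<open>quasi_inverse_unique\<close>), and in a von Neumann regular ring every \<open>b\<close> has one
(\<open>vN_regular_quasi_inverse\<close>). Passing from \<open>B\<close> to \<open>B\<^sup>+\<close> adds such a quasi-inverse for each
element of \<open>B\<close>. Hence a homomorphism from \<open>B\<close> to a von Neumann regular ring \<open>V\<close> extends to
\<open>B\<^sup>+\<close>, since the new variables can be sent to quasi-inverses in \<open>V\<close> (\<open>plus_lift\<close>), and it
extends in one way only, since there is no choice of quasi-inverse (\<open>plus_hom_eq\<close>). Both
properties pass to the colimit \<open>A\<^sub>\<omega>\<close>. Moreover \<open>A\<^sub>\<omega>\<close> is itself regular: each of its elements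
comes from some \<open>A\<^sub>n\<close> and has a quasi-inverse in \<open>A\<^bsub>n+1\<^esub>\<close> (\<open>vN_regular_A_omega\<close>).

The work lies in showing that the objects of the construction are \<open>C\<^sup>\<infinity>\<close>-rings with their
expected universal properties. This needs two facts of analysis. Smooth functions are closed
under composition, so that free rings are \<open>C\<^sup>\<infinity>\<close>-rings and the underlying structures are
commutative rings. Hadamard's lemma
\<open>f(v[i := s]) - f(v) = (s - v\<^sub>i) h(v, s)\<close> with \<open>h\<close> smooth implies that a ring ideal is a congruence
for all smooth operations, so that quotients are \<open>C\<^sup>\<infinity>\<close>-rings. The quotient
\<open>h(v, s) = \<integral>\<^sub>0\<^sup>1 \<partial>\<^sub>i f(v[i := v\<^sub>i + u (s - v\<^sub>i)]) du\<close> serves for both: its continuity alone gives the chain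
rule for functions with continuous partial derivatives, by changing one coordinate at a time,
and the chain rule in turn shows that \<open>h\<close> is smooth when \<open>f\<close> is.

Quotients, isomorphic copies and sequential colimits share one argument. In each case the new
structure \<open>Q\<close> receives homomorphisms from \<open>C\<^sup>\<infinity>\<close>-rings such that every finite list of elements
of \<open>Q\<close> lifts along one of them. The axioms and the universal property of \<open>Q\<close> follow from that
alone (\<open>cinf_ring_cover\<close>, \<open>cinf_cover_lift\<close>).\<close>

section \<open>Calculus of smooth functions on lists\<close>

text \<open>Truncation \<open>x \<mapsto> (x\<^sub>0, \<dots>, x\<^bsub>n-1\<^esub>, 0, 0, \<dots>)\<close> is continuous, so the restriction to sequences that
vanish from \<open>n\<close> on can be dropped, and continuity becomes that of a function on all of the
type \<^typ>\<open>nat \<Rightarrow> real\<close> with its product topology.\<close>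

lemma continuous_map_Euclidean_space_iff:
  "continuous_map (Euclidean_space n) euclideanreal (\<lambda>x. f (map x [0..<n])) \<longleftrightarrow>
   continuous_on UNIV (\<lambda>x::nat \<Rightarrow> real. f (map x [0..<n]))" (is "?L \<longleftrightarrow> ?R")
proof
  assume ?L
  then have c: "continuous_on {x. \<forall>i\<ge>n. x i = 0} (\<lambda>x::nat \<Rightarrow> real. f (map x [0..<n]))"
    by (simp add: Euclidean_space_def euclidean_product_topology)
  define \<tau> :: "(nat \<Rightarrow> real) \<Rightarrow> nat \<Rightarrow> real" where "\<tau> x = (\<lambda>i. if i < n then x i else 0)" for x
  have \<tau>: "continuous_on UNIV \<tau>"
  proof (rule continuous_on_coordinatewise_then_product)
    show "continuous_on UNIV (\<lambda>x. \<tau> x i)" for i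
      by (cases "i < n") (auto simp: \<tau>_def intro: continuous_on_product_coordinates)
  qed
  have "continuous_on UNIV (\<lambda>x. f (map (\<tau> x) [0..<n]))"
    by (rule continuous_on_compose2[OF c \<tau>]) (auto simp: \<tau>_def)
  moreover have "map (\<tau> x) [0..<n] = map x [0..<n]" for x
    by (simp add: \<tau>_def)
  ultimately show ?R by simp
next
  assume ?R
  then show ?L
    by (auto simp: Euclidean_space_def euclidean_product_topology intro: continuous_on_subset)
qed

lemma Ck_0_iff: "Ck n 0 f \<longleftrightarrow> continuous_on UNIV (\<lambda>x::nat \<Rightarrow> real. f (map x [0..<n]))"
  by (simp add: continuous_map_Euclidean_space_iff)

lemma Ck_Suc_iff:
  "Ck n (Suc k) f \<longleftrightarrow> Ck n 0 f \<and>
     (\<forall>i<n. \<exists>g. Ck n k g \<and>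
        (\<forall>v. length v = n \<longrightarrow> ((\<lambda>t. f (v[i := t])) has_real_derivative g v) (at (v ! i))))"
  by simp

text \<open>The characterisations above replace the defining equations, which mention the topology
\<^const>\<open>Euclidean_space\<close>.\<close>

declare Ck.simps [simp del]

lemma Ck_SucI:
  assumes "Ck n 0 f" and "\<And>i. i < n \<Longrightarrow> Ck n k (D i)"
    and "\<And>i v. i < n \<Longrightarrow> length v = n \<Longrightarrow>
           ((\<lambda>t. f (v[i := t])) has_real_derivative D i v) (at (v ! i))"
  shows "Ck n (Suc k) f"
  using assms unfolding Ck_Suc_iff by blast

lemma Ck_SucE:
  assumes "Ck n (Suc k) f"
  obtains D where "\<And>i. i < n \<Longrightarrow> Ck n k (D i)"
    and "\<And>i v. i < n \<Longrightarrow> length v = n \<Longrightarrow>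
           ((\<lambda>t. f (v[i := t])) has_real_derivative D i v) (at (v ! i))"
  using assms unfolding Ck_Suc_iff by metis

lemma Ck_imp_Ck_0: "Ck n k f \<Longrightarrow> Ck n 0 f"
  by (cases k) (auto simp: Ck_Suc_iff)

lemma Ck_SucD: "Ck n (Suc k) f \<Longrightarrow> Ck n k f"
proof (induction k arbitrary: f)
  case 0
  then show ?case by (rule Ck_imp_Ck_0)
next
  case (Suc k)
  from Suc.prems obtain D where "\<And>i. i < n \<Longrightarrow> Ck n (Suc k) (D i)"
    "\<And>i v. i < n \<Longrightarrow> length v = n \<Longrightarrow>
       ((\<lambda>t. f (v[i := t])) has_real_derivative D i v) (at (v ! i))"
    by (rule Ck_SucE) blast
  with Suc.IH show ?case
    by (intro Ck_SucI[where D = D] Ck_imp_Ck_0[OF Suc.prems]) auto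
qed

lemma Ck_cong:
  assumes "\<And>v. length v = n \<Longrightarrow> f v = g v"
  shows "Ck n k f \<longleftrightarrow> Ck n k g"
  using assms by (cases k) (simp_all add: Ck_0_iff Ck_Suc_iff)

lemma continuous_on_Ck_0:
  fixes w :: "'x::topological_space \<Rightarrow> real list"
  assumes f: "Ck m 0 f"
    and len: "\<And>x. x \<in> S \<Longrightarrow> length (w x) = m"
    and w: "\<And>j. j < m \<Longrightarrow> continuous_on S (\<lambda>x. w x ! j)"
  shows "continuous_on S (\<lambda>x. f (w x))"
proof -
  define W where "W x = (\<lambda>j. if j < m then w x ! j else 0)" for x
  have W: "continuous_on S W"
  proof (rule continuous_on_coordinatewise_then_product)
    show "continuous_on S (\<lambda>x. W x i)" for i
      by (cases "i < m") (auto simp: W_def intro: w)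
  qed
  have "continuous_on S (\<lambda>x. f (map (W x) [0..<m]))"
    by (rule continuous_on_compose2[OF f[unfolded Ck_0_iff] W]) auto
  moreover have "map (W x) [0..<m] = w x" if "x \<in> S" for x
    using len[OF that] by (auto simp: W_def list_eq_iff_nth_eq)
  ultimately show ?thesis by (simp cong: continuous_on_cong)
qed

lemma continuous_on_list_update_nth:
  assumes "\<And>j. j < m \<Longrightarrow> continuous_on S (\<lambda>x. w x ! j)" "continuous_on S c" 
   "\<And>x. x \<in> S \<Longrightarrow> length (w x) = m" "j < m"
  shows "continuous_on S (\<lambda>x. (w x)[i := c x] ! j)"
proof (cases "i = j")
  case True
  with assms show ?thesis by (simp cong: continuous_on_cong)
next
  case False
  with assms show ?thesis by simp
qed

lemma continuous_on_fst_coordinate: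
  fixes T :: "((nat \<Rightarrow> real) \<times> real) set"
  shows "continuous_on T (\<lambda>p. fst p j)"
  by (rule continuous_on_product_then_coordinatewise) (intro continuous_intros)

text \<open>The Hadamard difference quotient of \<open>f\<close> in direction \<open>i\<close>, where \<open>D\<close> is the \<open>i\<close>-th partial
derivative of \<open>f\<close>. The argument \<open>w\<close> is a point of \<open>\<real>\<^sup>n\<close> followed by the new value of its \<open>i\<close>-th
coordinate.\<close>

definition hadamard_quotient :: "nat \<Rightarrow> nat \<Rightarrow> (real list \<Rightarrow> real) \<Rightarrow> real list \<Rightarrow> real" where
  "hadamard_quotient n i D w =
     integral {0..1} (\<lambda>u. D ((take n w)[i := w ! i + u * (w ! n - w ! i)]))"

text \<open>The fundamental theorem of calculus on the segment from \<open>v\<close> to \<open>v[i := s]\<close>.\<close>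

lemma diff_eq_hadamard_quotient:
  assumes "i < n" "length v = n" and D: "Ck n 0 D"
    and f: "\<And>v. length v = n \<Longrightarrow> ((\<lambda>t. f (v[i := t])) has_real_derivative D v) (at (v ! i))"
  shows "f (v[i := s]) - f v = (s - v ! i) * hadamard_quotient n i D (v @ [s])"
proof -
  let ?p = "\<lambda>u. v ! i + u * (s - v ! i)"
  have d: "((\<lambda>u. f (v[i := ?p u])) has_vector_derivative (s - v ! i) * D (v[i := ?p u])) (at u within {0..1})" for u
  proof -
    have "((\<lambda>t. f (v[i := t])) has_real_derivative D (v[i := ?p u])) (at (?p u))"
      using f[of "v[i := ?p u]"] assms(1,2) by simp
    moreover have "(?p has_real_derivative (s - v ! i)) (at u)"
      by (auto intro!: derivative_eq_intros)
    ultimately have "((\<lambda>u. f (v[i := ?p u])) has_real_derivative D (v[i := ?p u]) * (s - v ! i)) (at u)"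
      by (rule DERIV_chain2)
    then show ?thesis
      by (simp add: has_real_derivative_iff_has_vector_derivative mult.commute has_vector_derivative_at_within)
  qed
  have "((\<lambda>u. (s - v ! i) * D (v[i := ?p u])) has_integral
      f (v[i := ?p 1]) - f (v[i := ?p 0])) {0..1}"
    by (rule fundamental_theorem_of_calculus) (use d in auto)
  from integral_unique[OF this] show ?thesis
    using assms(1,2) by (simp add: hadamard_quotient_def nth_append)
qed

lemma continuous_integral_Ck_0:
  fixes w :: "'x::topological_space \<Rightarrow> real \<Rightarrow> real list"
  assumes "Ck m 0 G" "\<And>x u. length (w x u) = m"
    and "\<And>j. j < m \<Longrightarrow> continuous_on (S \<times> {0..1}) (\<lambda>p. w (fst p) (snd p) ! j)"
  shows "continuous_on S (\<lambda>x. integral {0..1} (\<lambda>u. G (w x u)))"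
proof -
  have "continuous_on (S \<times> cbox 0 1) (\<lambda>(x, u). G (w x u))"
    using assms continuous_on_Ck_0[of m G "S \<times> {0..1}" "\<lambda>p. w (fst p) (snd p)"]
    by (simp add: case_prod_unfold)
  from integral_continuous_on_param[OF this] show ?thesis by simp
qed

lemma Ck_0_hadamard_quotient:
  assumes "Ck n 0 D" "i < n"
  shows "Ck (Suc n) 0 (hadamard_quotient n i D)"
proof -
  let ?w = "\<lambda>x u. (take n (map x [0..<Suc n]))[i := x i + u * (x n - x i)]"
  have eq: "take n (map x [0..<Suc n]) = map x [0..<n]" for x :: "nat \<Rightarrow> real" by simp
  have "continuous_on UNIV (\<lambda>x. integral {0..1} (\<lambda>u. D (?w x u)))"
    unfolding eq
    by (rule continuous_integral_Ck_0[OF assms(1)])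
      (auto intro!: continuous_on_list_update_nth[where m = n] continuous_intros continuous_on_fst_coordinate)
  then show ?thesis
    unfolding Ck_0_iff using assms(2) by (simp add: hadamard_quotient_def nth_append del: upt_Suc)
qed

text \<open>Telescoping along the path from \<open>b\<close> to \<open>a\<close> that changes one coordinate at a time reduces a
difference in all coordinates to the case of one coordinate.\<close>

lemma diff_eq_sum_hadamard_quotients:
  assumes D: "\<And>j. j < m \<Longrightarrow> Ck m 0 (D j)"
    and f: "\<And>j v. j < m \<Longrightarrow> length v = m \<Longrightarrow>
      ((\<lambda>t. f (v[j := t])) has_real_derivative D j v) (at (v ! j))"
    and len: "length a = m" "length b = m"
  shows "f a - f b = (\<Sum>j<m. (a ! j - b ! j) * hadamard_quotient m j (D j) ((take j a @ drop j b) @ [a ! j]))"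
proof -
  let ?w = "\<lambda>j. take j a @ drop j b"
  have "f a - f b = (\<Sum>j<m. f (?w (Suc j)) - f (?w j))"
    using len by (simp add: sum_lessThan_telescope[where f = "\<lambda>j. f (?w j)"])
  also have "\<dots> = (\<Sum>j<m. (a ! j - b ! j) * hadamard_quotient m j (D j) (?w j @ [a ! j]))"
  proof (rule sum.cong[OF refl])
    fix j assume "j \<in> {..<m}"
    then have j: "j < m" by simp
    have upd: "?w (Suc j) = (?w j)[j := a ! j]" and nth: "?w j ! j = b ! j"
      using j len by (auto simp: list_eq_iff_nth_eq nth_append nth_list_update min_def less_Suc_eq)
    from diff_eq_hadamard_quotient[OF j _ D[OF j] f[OF j], of "?w j" "a ! j"]
    show "f (?w (Suc j)) - f (?w j) = (a ! j - b ! j) * hadamard_quotient m j (D j) (?w j @ [a ! j])"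
      using j len by (simp only: upd nth) simp
  qed
  finally show ?thesis .
qed

text \<open>The chain rule needs total differentiability of \<open>f\<close> while only continuous partial derivatives
are given. The sum of Hadamard quotients bridges the gap: divided by \<open>t - t\<^sub>0\<close>, each summand is the
difference quotient of \<open>a\<^sub>j\<close> times a factor \<open>H\<^sub>j(t)\<close> that is continuous in \<open>t\<close> with
\<open>H\<^sub>j(t\<^sub>0) = D\<^sub>j(a(t\<^sub>0))\<close>. This continuity is why the coordinates \<open>a\<^sub>j\<close> are assumed
differentiable everywhere and not only at \<open>t\<^sub>0\<close>.\<close>

lemma has_real_derivative_Ck_compose:
  fixes a :: "real \<Rightarrow> real list"
  assumes D: "\<And>j. j < m \<Longrightarrow> Ck m 0 (D j)"
    and f: "\<And>j v. j < m \<Longrightarrow> length v = m \<Longrightarrow>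
      ((\<lambda>t. f (v[j := t])) has_real_derivative D j v) (at (v ! j))"
    and len: "\<And>t. length (a t) = m"
    and a: "\<And>j t. j < m \<Longrightarrow> ((\<lambda>t. a t ! j) has_real_derivative a' j t) (at t)"
  shows "((\<lambda>t. f (a t)) has_real_derivative (\<Sum>j<m. D j (a t0) * a' j t0)) (at t0)"
proof -
  define H where "H j t = hadamard_quotient m j (D j) ((take j (a t) @ drop j (a t0)) @ [a t ! j])" for j t
  have ca: "continuous_on UNIV (\<lambda>t. a t ! j)" if "j < m" for j
    using a[OF that] by (meson DERIV_isCont continuous_at_imp_continuous_on)
  have H: "H j \<midarrow>t0\<rightarrow> D j (a t0)" if j: "j < m" for j
  proof -
    have "continuous_on UNIV (H j)"
      unfolding H_def
    proof (rule continuous_on_Ck_0[OF Ck_0_hadamard_quotient[OF D[OF j] j]])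
      fix i assume "i < Suc m"
      then show "continuous_on UNIV (\<lambda>t. ((take j (a t) @ drop j (a t0)) @ [a t ! j]) ! i)"
        using j len
        by (cases "i < j"; cases "i = m") (auto simp: nth_append min_def diff_less_mono intro!: ca)
    qed (use j len in simp)
    then have "H j \<midarrow>t0\<rightarrow> H j t0"
      by (simp add: continuous_on_eq_continuous_at isCont_def)
    also have "H j t0 = D j (a t0)"
      using j len by (simp add: H_def hadamard_quotient_def nth_append)
    finally show ?thesis .
  qed
  have "(\<lambda>t. \<Sum>j<m. H j t * ((a t ! j - a t0 ! j) / (t - t0))) \<midarrow>t0\<rightarrow> (\<Sum>j<m. D j (a t0) * a' j t0)"
    using a by (intro tendsto_sum tendsto_mult H) (auto simp: has_field_derivative_iff)
  moreover have "(f (a t) - f (a t0)) / (t - t0) = (\<Sum>j<m. H j t * ((a t ! j - a t0 ! j) / (t - t0)))" for t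
    using diff_eq_sum_hadamard_quotients[OF D f len len, of t t0]
    by (simp add: H_def sum_divide_distrib mult.commute)
  ultimately show ?thesis by (simp add: has_field_derivative_iff)
qed

lemma Ck_const: "Ck n k (\<lambda>_. c)"
  by (induction k arbitrary: c)
    (auto simp: Ck_0_iff intro!: Ck_SucI[where D = "\<lambda>_ _. 0"])

lemma Ck_nth: "i < n \<Longrightarrow> Ck n k (\<lambda>v. v ! i)"
proof (cases k)
  case 0
  moreover assume "i < n"
  ultimately show ?thesis by (auto simp: Ck_0_iff intro: continuous_on_product_coordinates)
next
  case (Suc l)
  assume i: "i < n"
  have "((\<lambda>t. v[j := t] ! i) has_real_derivative (if j = i then 1 else 0)) (at (v ! j))"
    if "length v = n" for v and j
    using i that by (cases "j = i") auto
  moreover have "Ck n 0 (\<lambda>v. v ! i)"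
    using i by (auto simp: Ck_0_iff intro: continuous_on_product_coordinates)
  ultimately show ?thesis
    unfolding Suc by (intro Ck_SucI[where D = "\<lambda>j _. if j = i then 1 else 0"] Ck_const) auto
qed

lemma Ck_add: "Ck n k f \<Longrightarrow> Ck n k g \<Longrightarrow> Ck n k (\<lambda>v. f v + g v)"
proof (induction k arbitrary: f g)
  case 0
  then show ?case by (auto simp: Ck_0_iff intro: continuous_intros)
next
  case (Suc k)
  obtain Df where Df: "\<And>i. i < n \<Longrightarrow> Ck n k (Df i)"
    "\<And>i v. i < n \<Longrightarrow> length v = n \<Longrightarrow>
       ((\<lambda>t. f (v[i := t])) has_real_derivative Df i v) (at (v ! i))"
    using Suc.prems(1) by (rule Ck_SucE) blast
  obtain Dg where Dg: "\<And>i. i < n \<Longrightarrow> Ck n k (Dg i)"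
    "\<And>i v. i < n \<Longrightarrow> length v = n \<Longrightarrow>
       ((\<lambda>t. g (v[i := t])) has_real_derivative Dg i v) (at (v ! i))"
    using Suc.prems(2) by (rule Ck_SucE) blast
  show ?case
  proof (rule Ck_SucI)
    show "Ck n 0 (\<lambda>v. f v + g v)"
      using Suc.prems[THEN Ck_imp_Ck_0] by (auto simp: Ck_0_iff intro: continuous_intros)
    show "Ck n k (\<lambda>v. Df i v + Dg i v)" if "i < n" for i
      using that by (intro Suc.IH Df Dg)
    show "((\<lambda>t. f (v[i := t]) + g (v[i := t])) has_real_derivative Df i v + Dg i v) (at (v ! i))"
      if "i < n" "length v = n" for i v
      using that by (intro DERIV_add Df Dg)
  qed
qed

lemma Ck_mult: "Ck n k f \<Longrightarrow> Ck n k g \<Longrightarrow> Ck n k (\<lambda>v. f v * g v)"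
proof (induction k arbitrary: f g)
  case 0
  then show ?case by (auto simp: Ck_0_iff intro: continuous_intros)
next
  case (Suc k)
  obtain Df where Df: "\<And>i. i < n \<Longrightarrow> Ck n k (Df i)"
    "\<And>i v. i < n \<Longrightarrow> length v = n \<Longrightarrow>
       ((\<lambda>t. f (v[i := t])) has_real_derivative Df i v) (at (v ! i))"
    using Suc.prems(1) by (rule Ck_SucE) blast
  obtain Dg where Dg: "\<And>i. i < n \<Longrightarrow> Ck n k (Dg i)"
    "\<And>i v. i < n \<Longrightarrow> length v = n \<Longrightarrow>
       ((\<lambda>t. g (v[i := t])) has_real_derivative Dg i v) (at (v ! i))"
    using Suc.prems(2) by (rule Ck_SucE) blast
  show ?case
  proof (rule Ck_SucI)
    show "Ck n 0 (\<lambda>v. f v * g v)"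
      using Suc.prems[THEN Ck_imp_Ck_0] by (auto simp: Ck_0_iff intro: continuous_intros)
    show "Ck n k (\<lambda>v. Df i v * g v + Dg i v * f v)" if "i < n" for i
      using that by (intro Ck_add Suc.IH Df Dg Suc.prems[THEN Ck_SucD])
    show "((\<lambda>t. f (v[i := t]) * g (v[i := t])) has_real_derivative
        Df i v * g v + Dg i v * f v) (at (v ! i))" if "i < n" "length v = n" for i v
      using DERIV_mult[OF Df(2)[OF that] Dg(2)[OF that]] by simp
  qed
qed

lemma Ck_sum: "(\<And>j. j < m \<Longrightarrow> Ck n k (f j)) \<Longrightarrow> Ck n k (\<lambda>v. \<Sum>j<(m::nat). f j v)"
  by (induction m) (auto intro: Ck_const Ck_add)

text \<open>By the chain rule, the partial derivatives of a composite are sums of products in which one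
factor is a composite one degree lower.\<close>

lemma Ck_compose:
  assumes "Ck m k f" "length gs = m" "\<And>g. g \<in> set gs \<Longrightarrow> Ck n k g"
  shows "Ck n k (\<lambda>v. f (map (\<lambda>g. g v) gs))"
  using assms
proof (induction k arbitrary: f gs)
  case 0
  then show ?case
    unfolding Ck_0_iff[of n]
    by (intro continuous_on_Ck_0[OF "0.prems"(1)]) (auto simp: Ck_0_iff)
next
  case (Suc k)
  obtain Df where Df: "\<And>j. j < m \<Longrightarrow> Ck m k (Df j)"
    "\<And>j v. j < m \<Longrightarrow> length v = m \<Longrightarrow>
       ((\<lambda>t. f (v[j := t])) has_real_derivative Df j v) (at (v ! j))"
    using Suc.prems(1) by (rule Ck_SucE) blast
  have "\<exists>D. (\<forall>i<n. Ck n k (D i)) \<and> (\<forall>i v. i < n \<longrightarrow> length v = n \<longrightarrow>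
      ((\<lambda>t. (gs ! j) (v[i := t])) has_real_derivative D i v) (at (v ! i)))" if "j < m" for j
    using Suc.prems(2,3) that by (metis Ck_SucE nth_mem)
  then obtain Dg where Dg: "\<And>j i. j < m \<Longrightarrow> i < n \<Longrightarrow> Ck n k (Dg j i)"
    "\<And>j i v. j < m \<Longrightarrow> i < n \<Longrightarrow> length v = n \<Longrightarrow>
      ((\<lambda>t. (gs ! j) (v[i := t])) has_real_derivative Dg j i v) (at (v ! i))"
    by metis
  show ?case
  proof (rule Ck_SucI)
    show "Ck n 0 (\<lambda>v. f (map (\<lambda>g. g v) gs))"
      unfolding Ck_0_iff[of n] using Suc.prems(2) Suc.prems(3)[THEN Ck_imp_Ck_0]
      by (intro continuous_on_Ck_0[OF Ck_imp_Ck_0[OF Suc.prems(1)]]) (auto simp: Ck_0_iff)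
    show "Ck n k (\<lambda>v. \<Sum>j<m. Df j (map (\<lambda>g. g v) gs) * Dg j i v)" if "i < n" for i
    proof (intro Ck_sum Ck_mult Dg that)
      show "Ck n k (\<lambda>v. Df j (map (\<lambda>g. g v) gs))" if "j < m" for j
        by (rule Suc.IH[OF Df(1)[OF that] Suc.prems(2)]) (rule Ck_SucD[OF Suc.prems(3)])
    qed
    show "((\<lambda>t. f (map (\<lambda>g. g (v[i := t])) gs)) has_real_derivative
        (\<Sum>j<m. Df j (map (\<lambda>g. g v) gs) * Dg j i v)) (at (v ! i))"
      if "i < n" "length v = n" for i v
    proof -
      have "((\<lambda>t. map (\<lambda>g. g (v[i := t])) gs ! j) has_real_derivative Dg j i (v[i := t])) (at t)"
        if "j < m" for j t
        using Dg(2)[OF that, of i "v[i := t]"] \<open>i < n\<close> \<open>length v = n\<close> Suc.prems(2) that by simp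
      from has_real_derivative_Ck_compose[where ?t0.0 = "v ! i" and f = f and D = Df and m = m
          and a = "\<lambda>t. map (\<lambda>g. g (v[i := t])) gs", OF Ck_imp_Ck_0[OF Df(1)] Df(2) _ this]
      show ?thesis using Suc.prems(2) that by simp
    qed
  qed
qed

lemma Ck_0_integral:
  assumes "Ck (Suc n) 0 G"
  shows "Ck n 0 (\<lambda>v. integral {0..1} (\<lambda>u. G (v @ [u])))"
  unfolding Ck_0_iff[of n]
proof (rule continuous_integral_Ck_0[OF assms])
  show "continuous_on (UNIV \<times> {0..1}) (\<lambda>p. (map (fst p) [0..<n] @ [snd p :: real]) ! j)"
    if "j < Suc n" for j
    using that
    by (cases "j < n") (auto simp: nth_append intro!: continuous_intros continuous_on_fst_coordinate)
qed simp

text \<open>Differentiation under the integral sign, where the last coordinate is integrated out. This is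
what makes Hadamard quotients smooth.\<close>

lemma Ck_integral:
  assumes "Ck (Suc n) k G"
  shows "Ck n k (\<lambda>v. integral {0..1} (\<lambda>u. G (v @ [u])))"
  using assms
proof (induction k arbitrary: G)
  case 0
  then show ?case by (rule Ck_0_integral)
next
  case (Suc k)
  obtain D where D: "\<And>j. j < Suc n \<Longrightarrow> Ck (Suc n) k (D j)"
    "\<And>j v. j < Suc n \<Longrightarrow> length v = Suc n \<Longrightarrow>
       ((\<lambda>t. G (v[j := t])) has_real_derivative D j v) (at (v ! j))"
    using Suc.prems(1) by (rule Ck_SucE) blast
  show ?case
  proof (rule Ck_SucI)
    show "Ck n 0 (\<lambda>v. integral {0..1} (\<lambda>u. G (v @ [u])))"
      by (rule Ck_0_integral[OF Ck_imp_Ck_0[OF Suc.prems]])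
    show "Ck n k (\<lambda>v. integral {0..1} (\<lambda>u. D i (v @ [u])))" if "i < n" for i
      using that by (intro Suc.IH D) simp
    show "((\<lambda>t. integral {0..1} (\<lambda>u. G (v[i := t] @ [u]))) has_real_derivative
        integral {0..1} (\<lambda>u. D i (v @ [u]))) (at (v ! i))" if i: "i < n" and v: "length v = n" for i v
    proof -
      have cont: "continuous_on (S \<times> {0..1}) (\<lambda>(t, u). F (v[i := t] @ [u]))"
        if "Ck (Suc n) 0 F" for F S
      proof -
        have "continuous_on (S \<times> {0..1}) (\<lambda>p. (v[i := fst p] @ [snd p]) ! j)" if "j < Suc n" for j
          using v that
          by (cases "j = i"; cases "j < n") (auto simp: nth_append nth_list_update intro!: continuous_intros)
        then show ?thesis
          using continuous_on_Ck_0[OF that, of "S \<times> {0..1}" "\<lambda>p. v[i := fst p] @ [snd p]"] v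
          by (simp add: case_prod_unfold)
      qed
      have "((\<lambda>t. integral (cbox 0 1) (\<lambda>u. G (v[i := t] @ [u]))) has_real_derivative
          integral (cbox 0 1) (\<lambda>u. D i (v[i := v ! i] @ [u]))) (at (v ! i) within UNIV)"
      proof (rule leibniz_rule_field_derivative)
        show "((\<lambda>t. G (v[i := t] @ [u])) has_real_derivative D i (v[i := t] @ [u])) (at t within UNIV)" for t u
          using D(2)[of i "v[i := t] @ [u]"] i v by (simp add: list_update_append nth_append)
        show "(\<lambda>u. G (v[i := t] @ [u])) integrable_on cbox 0 1" for t
        proof (rule integrable_continuous)
          show "continuous_on (cbox 0 1) (\<lambda>u. G (v[i := t] @ [u]))"
            using continuous_on_compose2[OF cont[OF Ck_imp_Ck_0[OF Suc.prems], of UNIV],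
                of "{0..1}" "Pair t"]
            by (simp add: continuous_on_Pair continuous_on_const continuous_on_id image_subset_iff)
        qed
        show "continuous_on (UNIV \<times> cbox 0 1) (\<lambda>(t, u). D i (v[i := t] @ [u]))"
          using cont[OF Ck_imp_Ck_0[OF D(1)]] i by simp
      qed auto
      then show ?thesis by simp
    qed
  qed
qed


section \<open>Smooth functions and Hadamard's lemma\<close>

lemma smooth_congI:
  assumes "smooth n f" "\<And>v. length v = n \<Longrightarrow> f v = g v"
  shows "smooth n g"
  using assms(1) Ck_cong[of n f g, OF assms(2)] by (simp add: smooth_def)

lemma smooth_const [intro]: "smooth n (\<lambda>_. c)"
  by (simp add: smooth_def Ck_const)

lemma smooth_nth [intro]: "i < n \<Longrightarrow> smooth n (\<lambda>v. v ! i)"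
  by (simp add: smooth_def Ck_nth)

lemma smooth_add [intro]: "smooth n f \<Longrightarrow> smooth n g \<Longrightarrow> smooth n (\<lambda>v. f v + g v)"
  by (simp add: smooth_def Ck_add)

lemma smooth_mult [intro]: "smooth n f \<Longrightarrow> smooth n g \<Longrightarrow> smooth n (\<lambda>v. f v * g v)"
  by (simp add: smooth_def Ck_mult)

lemma smooth_uminus [intro]: "smooth n f \<Longrightarrow> smooth n (\<lambda>v. - f v)"
  using smooth_mult[OF smooth_const[of n "- 1"], of f] by simp

lemma smooth_diff [intro]: "smooth n f \<Longrightarrow> smooth n g \<Longrightarrow> smooth n (\<lambda>v. f v - g v)"
  using smooth_add[OF _ smooth_uminus, of n f g] by simp

lemma smooth_compose:
  assumes "smooth m f" "length gs = m" "\<And>g. g \<in> set gs \<Longrightarrow> smooth n g"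
  shows "smooth n (\<lambda>v. f (map (\<lambda>g. g v) gs))"
  unfolding smooth_def
proof
  show "Ck n k (\<lambda>v. f (map (\<lambda>g. g v) gs))" for k
    by (rule Ck_compose[where m = m]) (use assms in \<open>auto simp: smooth_def\<close>)
qed

text \<open>A reformulation of composition for an inner map that is written as a list-valued expression,
such as \<open>take n w\<close> or a list update, instead of a list of functions.\<close>

lemma smooth_compose_nth:
  assumes "smooth m f" "\<And>j. j < m \<Longrightarrow> smooth n (\<lambda>v. w v ! j)"
    "\<And>v. length v = n \<Longrightarrow> length (w v) = m"
  shows "smooth n (\<lambda>v. f (w v))"
proof -
  let ?gs = "map (\<lambda>j v. w v ! j) [0..<m]"
  have "smooth n (\<lambda>v. f (map (\<lambda>g. g v) ?gs))"
    by (rule smooth_compose[OF assms(1)]) (use assms(2) in auto)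
  then show ?thesis
  proof (rule smooth_congI)
    show "f (map (\<lambda>g. g v) ?gs) = f (w v)" if "length v = n" for v
      using assms(3)[OF that] map_nth[of "w v"] by (simp add: comp_def)
  qed
qed

text \<open>The definition of \<open>Ck\<close> provides a partial derivative separately for each order of
differentiability; uniqueness of derivatives shows that one function serves for all orders.\<close>

lemma smooth_derivative:
  assumes "smooth n f" "i < n"
  obtains D where "smooth n D"
    "\<And>v. length v = n \<Longrightarrow> ((\<lambda>t. f (v[i := t])) has_real_derivative D v) (at (v ! i))"
proof -
  define D where "D v = deriv (\<lambda>t. f (v[i := t])) (v ! i)" for v
  have D: "Ck n k D \<and>
      (\<forall>v. length v = n \<longrightarrow> ((\<lambda>t. f (v[i := t])) has_real_derivative D v) (at (v ! i)))" for k
  proof -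
    have "Ck n (Suc k) f"
      using assms(1) by (simp add: smooth_def)
    then obtain g where g: "Ck n k g"
      "\<And>v. length v = n \<Longrightarrow> ((\<lambda>t. f (v[i := t])) has_real_derivative g v) (at (v ! i))"
      using assms(2) unfolding Ck_Suc_iff by auto
    have eq: "D v = g v" if "length v = n" for v
      unfolding D_def by (rule DERIV_imp_deriv[OF g(2)[OF that]])
    show ?thesis
      using g(1) Ck_cong[of n D g k, OF eq] g(2) eq by simp
  qed
  show thesis
    by (rule that[of D]) (use D in \<open>simp_all add: smooth_def\<close>)
qed

lemma Hadamard_lemma:
  assumes "smooth n f" "i < n"
  obtains h where "smooth (Suc n) h"
    "\<And>v s. length v = n \<Longrightarrow> f (v[i := s]) - f v = (s - v ! i) * h (v @ [s])"
proof -
  obtain D where D: "smooth n D"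
    "\<And>v. length v = n \<Longrightarrow> ((\<lambda>t. f (v[i := t])) has_real_derivative D v) (at (v ! i))"
    by (rule smooth_derivative[OF assms]) (erule that, assumption)
  \<comment> \<open>The integrand as a smooth function of the point, the new value at index \<open>n\<close>, and the
      integration variable at index \<open>n + 1\<close>.\<close>
  have "smooth (Suc (Suc n)) (\<lambda>w. D ((take n w)[i := w ! i + w ! Suc n * (w ! n - w ! i)]))"
  proof (rule smooth_compose_nth[OF D(1)])
    fix j assume "j < n"
    then have "smooth (Suc (Suc n)) (\<lambda>w. if j = i then w ! i + w ! Suc n * (w ! n - w ! i) else w ! j)"
      using assms(2) by (cases "j = i") (auto intro!: smooth_add smooth_mult smooth_diff smooth_nth)
    then show "smooth (Suc (Suc n)) (\<lambda>w. (take n w)[i := w ! i + w ! Suc n * (w ! n - w ! i)] ! j)"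
      by (rule smooth_congI) (use \<open>j < n\<close> in auto)
  qed simp
  then have "smooth (Suc n) (\<lambda>v. integral {0..1} (\<lambda>u.
      D ((take n (v @ [u]))[i := (v @ [u]) ! i + (v @ [u]) ! Suc n * ((v @ [u]) ! n - (v @ [u]) ! i)])))"
    unfolding smooth_def by (intro allI Ck_integral) simp
  then have "smooth (Suc n) (hadamard_quotient n i D)"
    by (rule smooth_congI) (use assms(2) in \<open>auto simp: hadamard_quotient_def nth_append\<close>)
  moreover have "f (v[i := s]) - f v = (s - v ! i) * hadamard_quotient n i D (v @ [s])" if "length v = n" for v s
    using D by (intro diff_eq_hadamard_quotient assms(2) that) (auto simp: smooth_def)
  ultimately show thesis by (rule that)
qed


section \<open>The underlying commutative ring\<close>

lemma opr_closed:
  assumes "cinf_ring A" "smooth n f" "length as = n" "set as \<subseteq> carrier A"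
  shows "opr A n f as \<in> carrier A"
  using assms(1)[unfolded cinf_ring_def, THEN conjunct1] assms(2-) by blast

lemma opr_nth:
  assumes "cinf_ring A" "i < n" "length as = n" "set as \<subseteq> carrier A"
  shows "opr A n (\<lambda>v. v ! i) as = as ! i"
  using assms(1)[unfolded cinf_ring_def, THEN conjunct2, THEN conjunct1] assms(2-) by blast

lemma opr_compose:
  assumes "cinf_ring A" "smooth m f" "length gs = m" "\<And>g. g \<in> set gs \<Longrightarrow> smooth n g"
    "length as = n" "set as \<subseteq> carrier A"
  shows "opr A n (\<lambda>v. f (map (\<lambda>g. g v) gs)) as = opr A m f (map (\<lambda>g. opr A n g as) gs)"
  by (rule assms(1)[unfolded cinf_ring_def, THEN conjunct2, THEN conjunct2, rule_format])
    (use assms(2-) in simp)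

text \<open>Since \<open>f\<close> and its composite with the \<open>n\<close> projections induce the same operation, only the values
of \<open>f\<close> on lists of length \<open>n\<close> matter. This is how identities between smooth functions become
identities in every \<open>C\<^sup>\<infinity>\<close>-ring.\<close>

lemma opr_cong:
  assumes A: "cinf_ring A" and f: "smooth n f" and as: "length as = n" "set as \<subseteq> carrier A"
    and eq: "\<And>v. length v = n \<Longrightarrow> f v = g v"
  shows "opr A n f as = opr A n g as"
proof -
  let ?ps = "map (\<lambda>i v. v ! i) [0..<n] :: (real list \<Rightarrow> real) list"
  have g: "smooth n g" using f eq by (rule smooth_congI)
  have "opr A n h as = opr A n (\<lambda>v. h (map (\<lambda>g. g v) ?ps)) as" if "smooth n h" for h
  proof -
    have "opr A n (\<lambda>v. h (map (\<lambda>g. g v) ?ps)) as = opr A n h (map (\<lambda>g. opr A n g as) ?ps)"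
      by (rule opr_compose[OF A that _ _ as]) (auto intro: smooth_nth)
    also have "map (\<lambda>g. opr A n g as) ?ps = as"
      using as by (auto simp: list_eq_iff_nth_eq opr_nth[OF A])
    finally show ?thesis by simp
  qed
  from this[OF f] this[OF g] show ?thesis
    using eq by simp
qed

lemma opr_compose_nth:
  assumes "cinf_ring A" "smooth m f" "\<And>j. j < m \<Longrightarrow> smooth n (\<lambda>v. w v ! j)"
    "\<And>v. length v = n \<Longrightarrow> length (w v) = m" "length as = n" "set as \<subseteq> carrier A"
  shows "opr A n (\<lambda>v. f (w v)) as = opr A m f (map (\<lambda>j. opr A n (\<lambda>v. w v ! j) as) [0..<m])"
proof -
  let ?gs = "map (\<lambda>j v. w v ! j) [0..<m]"
  have "opr A n (\<lambda>v. f (w v)) as = opr A n (\<lambda>v. f (map (\<lambda>g. g v) ?gs)) as"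
  proof (rule opr_cong[OF assms(1) smooth_compose_nth[OF assms(2-4)] assms(5,6)])
    show "f (w v) = f (map (\<lambda>g. g v) ?gs)" if "length v = n" for v
      using assms(4)[OF that] map_nth[of "w v"] by (simp add: comp_def)
  qed
  also have "\<dots> = opr A m f (map (\<lambda>g. opr A n g as) ?gs)"
    by (rule opr_compose[OF assms(1,2)]) (use assms(3,5,6) in auto)
  finally show ?thesis by (simp add: comp_def)
qed

lemma ring_of_carrier [simp]: "carrier (ring_of A) = carrier A"
  by (simp add: ring_of_def)

lemma opr_add:
  assumes "cinf_ring A" "smooth n f" "smooth n g" "length as = n" "set as \<subseteq> carrier A"
  shows "opr A n (\<lambda>v. f v + g v) as = opr A n f as \<oplus>\<^bsub>ring_of A\<^esub> opr A n g as"
  using opr_compose[OF assms(1) _ _ _ assms(4,5), of 2 "\<lambda>v. v ! 0 + v ! 1" "[f, g]"] assms(2,3)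
  by (auto simp: ring_of_def smooth_add smooth_nth)

lemma opr_mult:
  assumes "cinf_ring A" "smooth n f" "smooth n g" "length as = n" "set as \<subseteq> carrier A"
  shows "opr A n (\<lambda>v. f v * g v) as = opr A n f as \<otimes>\<^bsub>ring_of A\<^esub> opr A n g as"
  using opr_compose[OF assms(1) _ _ _ assms(4,5), of 2 "\<lambda>v. v ! 0 * v ! 1" "[f, g]"] assms(2,3)
  by (auto simp: ring_of_def smooth_mult smooth_nth)

lemma opr_const:
  assumes "cinf_ring A" "length as = n" "set as \<subseteq> carrier A"
  shows "opr A n (\<lambda>_. c) as = opr A 0 (\<lambda>_. c) []"
  using opr_compose[OF assms(1) _ _ _ assms(2,3), of 0 "\<lambda>_. c" "[]"]
  by (simp add: smooth_const)

text \<open>Each ring axiom is an identity in at most three variables that holds for real numbers. Any three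
elements \<open>a\<close>, \<open>b\<close>, \<open>c\<close> are the values of the three projections under the evaluation \<open>E a b c\<close>
of smooth functions, and the evaluation commutes with sums and products; so the axiom transfers
from the ring of smooth functions on \<open>\<real>\<^sup>3\<close>.\<close>

lemma cring_ring_of:
  assumes A: "cinf_ring A"
  shows "cring (ring_of A)"
proof -
  define E where "E a b c f = opr A 3 f [a, b, c]" for a b c f
  have E: "E a b c f \<in> carrier A" if "a \<in> carrier A" "b \<in> carrier A" "c \<in> carrier A" "smooth 3 f" for a b c f
    unfolding E_def by (rule opr_closed[OF A]) (use that in auto)
  have nth: "E a b c (\<lambda>v. v ! 0) = a" "E a b c (\<lambda>v. v ! 1) = b" "E a b c (\<lambda>v. v ! 2) = c"
    if "a \<in> carrier A" "b \<in> carrier A" "c \<in> carrier A" for a b c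
    using that by (simp_all add: E_def opr_nth[OF A])
  have add: "E a b c f \<oplus>\<^bsub>ring_of A\<^esub> E a b c g = E a b c (\<lambda>v. f v + g v)"
    if "a \<in> carrier A" "b \<in> carrier A" "c \<in> carrier A" "smooth 3 f" "smooth 3 g" for a b c f g
    unfolding E_def using that by (simp add: opr_add[OF A])
  have mult: "E a b c f \<otimes>\<^bsub>ring_of A\<^esub> E a b c g = E a b c (\<lambda>v. f v * g v)"
    if "a \<in> carrier A" "b \<in> carrier A" "c \<in> carrier A" "smooth 3 f" "smooth 3 g" for a b c f g
    unfolding E_def using that by (simp add: opr_mult[OF A])
  have zero: "\<zero>\<^bsub>ring_of A\<^esub> = E a b c (\<lambda>_. 0)" and one: "\<one>\<^bsub>ring_of A\<^esub> = E a b c (\<lambda>_. 1)"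
    if "a \<in> carrier A" "b \<in> carrier A" "c \<in> carrier A" for a b c
    unfolding E_def using that by (simp_all add: opr_const[OF A, of "[a, b, c]" 3] ring_of_def)
  have p: "smooth 3 (\<lambda>v. v ! 0)" "smooth 3 (\<lambda>v. v ! 1)" "smooth 3 (\<lambda>v. v ! 2)"
    by (auto intro: smooth_nth)
  note sm = p smooth_add smooth_mult smooth_const smooth_uminus
  have add_closed: "a \<oplus>\<^bsub>ring_of A\<^esub> b \<in> carrier A" if "a \<in> carrier A" "b \<in> carrier A" for a b
    using add[of a b a, OF _ _ _ p(1,2)] E[of a b a, OF _ _ _ smooth_add[OF p(1,2)]] nth[of a b a] that
    by simp
  have mult_closed: "a \<otimes>\<^bsub>ring_of A\<^esub> b \<in> carrier A" if "a \<in> carrier A" "b \<in> carrier A" for a b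
    using mult[of a b a, OF _ _ _ p(1,2)] E[of a b a, OF _ _ _ smooth_mult[OF p(1,2)]] nth[of a b a] that
    by simp
  have zero_closed: "\<zero>\<^bsub>ring_of A\<^esub> \<in> carrier A" and one_closed: "\<one>\<^bsub>ring_of A\<^esub> \<in> carrier A"
    by (auto simp: ring_of_def intro!: opr_closed[OF A] smooth_const)
  show ?thesis
  proof (rule cringI)
    show "abelian_group (ring_of A)"
    proof (rule abelian_groupI; simp add: add_closed zero_closed)
      fix a b c assume abc: "a \<in> carrier A" "b \<in> carrier A" "c \<in> carrier A"
      have "(E a b c (\<lambda>v. v ! 0) \<oplus>\<^bsub>ring_of A\<^esub> E a b c (\<lambda>v. v ! 1)) \<oplus>\<^bsub>ring_of A\<^esub> E a b c (\<lambda>v. v ! 2)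
        = E a b c (\<lambda>v. v ! 0) \<oplus>\<^bsub>ring_of A\<^esub> (E a b c (\<lambda>v. v ! 1) \<oplus>\<^bsub>ring_of A\<^esub> E a b c (\<lambda>v. v ! 2))"
        by (simp only: add abc sm add.assoc)
      then show "a \<oplus>\<^bsub>ring_of A\<^esub> b \<oplus>\<^bsub>ring_of A\<^esub> c = a \<oplus>\<^bsub>ring_of A\<^esub> (b \<oplus>\<^bsub>ring_of A\<^esub> c)"
        by (simp only: nth abc)
    next
      fix a b assume ab: "a \<in> carrier A" "b \<in> carrier A"
      have "E a b a (\<lambda>v. v ! 0) \<oplus>\<^bsub>ring_of A\<^esub> E a b a (\<lambda>v. v ! 1)
        = E a b a (\<lambda>v. v ! 1) \<oplus>\<^bsub>ring_of A\<^esub> E a b a (\<lambda>v. v ! 0)"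
        by (simp only: add ab sm add.commute)
      then show "a \<oplus>\<^bsub>ring_of A\<^esub> b = b \<oplus>\<^bsub>ring_of A\<^esub> a"
        by (simp only: nth ab)
    next
      fix a assume a: "a \<in> carrier A"
      have "E a a a (\<lambda>_. 0) \<oplus>\<^bsub>ring_of A\<^esub> E a a a (\<lambda>v. v ! 0) = E a a a (\<lambda>v. v ! 0)"
        by (simp only: add a sm add_0_left)
      then show "\<zero>\<^bsub>ring_of A\<^esub> \<oplus>\<^bsub>ring_of A\<^esub> a = a"
        by (simp only: nth zero[OF a a a, symmetric] a)
      have "E a a a (\<lambda>v. - (v ! 0)) \<oplus>\<^bsub>ring_of A\<^esub> E a a a (\<lambda>v. v ! 0) = E a a a (\<lambda>_. 0)"
        by (simp only: add a sm add.left_inverse)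
      then have "E a a a (\<lambda>v. - (v ! 0)) \<oplus>\<^bsub>ring_of A\<^esub> a = \<zero>\<^bsub>ring_of A\<^esub>"
        by (simp only: nth zero[OF a a a, symmetric] a)
      then show "\<exists>b\<in>carrier A. b \<oplus>\<^bsub>ring_of A\<^esub> a = \<zero>\<^bsub>ring_of A\<^esub>"
        using E[OF a a a smooth_uminus[OF p(1)]] by blast
    qed
    show "comm_monoid (ring_of A)"
    proof (rule comm_monoidI; simp add: mult_closed one_closed)
      fix a b c assume abc: "a \<in> carrier A" "b \<in> carrier A" "c \<in> carrier A"
      have "(E a b c (\<lambda>v. v ! 0) \<otimes>\<^bsub>ring_of A\<^esub> E a b c (\<lambda>v. v ! 1)) \<otimes>\<^bsub>ring_of A\<^esub> E a b c (\<lambda>v. v ! 2)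
        = E a b c (\<lambda>v. v ! 0) \<otimes>\<^bsub>ring_of A\<^esub> (E a b c (\<lambda>v. v ! 1) \<otimes>\<^bsub>ring_of A\<^esub> E a b c (\<lambda>v. v ! 2))"
        by (simp only: mult abc sm mult.assoc)
      then show "a \<otimes>\<^bsub>ring_of A\<^esub> b \<otimes>\<^bsub>ring_of A\<^esub> c = a \<otimes>\<^bsub>ring_of A\<^esub> (b \<otimes>\<^bsub>ring_of A\<^esub> c)"
        by (simp only: nth abc)
    next
      fix a b assume ab: "a \<in> carrier A" "b \<in> carrier A"
      have "E a b a (\<lambda>v. v ! 0) \<otimes>\<^bsub>ring_of A\<^esub> E a b a (\<lambda>v. v ! 1)
        = E a b a (\<lambda>v. v ! 1) \<otimes>\<^bsub>ring_of A\<^esub> E a b a (\<lambda>v. v ! 0)"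
        by (simp only: mult ab sm mult.commute)
      then show "a \<otimes>\<^bsub>ring_of A\<^esub> b = b \<otimes>\<^bsub>ring_of A\<^esub> a"
        by (simp only: nth ab)
    next
      fix a assume a: "a \<in> carrier A"
      have "E a a a (\<lambda>_. 1) \<otimes>\<^bsub>ring_of A\<^esub> E a a a (\<lambda>v. v ! 0) = E a a a (\<lambda>v. v ! 0)"
        by (simp only: mult a sm mult_1_left)
      then show "\<one>\<^bsub>ring_of A\<^esub> \<otimes>\<^bsub>ring_of A\<^esub> a = a"
        by (simp only: nth one[OF a a a, symmetric] a)
    qed
    fix a b c assume "a \<in> carrier (ring_of A)" "b \<in> carrier (ring_of A)" "c \<in> carrier (ring_of A)"
    then have abc: "a \<in> carrier A" "b \<in> carrier A" "c \<in> carrier A" by simp_all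
    have "(E a b c (\<lambda>v. v ! 0) \<oplus>\<^bsub>ring_of A\<^esub> E a b c (\<lambda>v. v ! 1)) \<otimes>\<^bsub>ring_of A\<^esub> E a b c (\<lambda>v. v ! 2)
      = E a b c (\<lambda>v. v ! 0) \<otimes>\<^bsub>ring_of A\<^esub> E a b c (\<lambda>v. v ! 2)
        \<oplus>\<^bsub>ring_of A\<^esub> E a b c (\<lambda>v. v ! 1) \<otimes>\<^bsub>ring_of A\<^esub> E a b c (\<lambda>v. v ! 2)"
      by (simp only: add mult abc sm distrib_right)
    then show "(a \<oplus>\<^bsub>ring_of A\<^esub> b) \<otimes>\<^bsub>ring_of A\<^esub> c = a \<otimes>\<^bsub>ring_of A\<^esub> c \<oplus>\<^bsub>ring_of A\<^esub> b \<otimes>\<^bsub>ring_of A\<^esub> c"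
      by (simp only: nth abc)
  qed
qed

lemma opr_diff:
  assumes A: "cinf_ring A" and f: "smooth n f" and g: "smooth n g"
    and as: "length as = n" "set as \<subseteq> carrier A"
  shows "opr A n (\<lambda>v. f v - g v) as = opr A n f as \<ominus>\<^bsub>ring_of A\<^esub> opr A n g as"
proof -
  interpret cring "ring_of A" by (rule cring_ring_of[OF A])
  have "opr A n f as = opr A n (\<lambda>v. f v - g v) as \<oplus>\<^bsub>ring_of A\<^esub> opr A n g as"
    using opr_add[OF A smooth_diff[OF f g] g as] by simp
  moreover have "opr A n (\<lambda>v. f v - g v) as \<in> carrier (ring_of A)" "opr A n g as \<in> carrier (ring_of A)"
    using opr_closed[OF A _ as] f g by auto
  ultimately show ?thesis
    by (simp add: a_minus_def a_assoc r_neg del: ring_of_carrier)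
qed


section \<open>Homomorphisms\<close>

lemma cinf_homI:
  assumes "\<And>a. a \<in> carrier A \<Longrightarrow> h a \<in> carrier B"
    and "\<And>n f as. smooth n f \<Longrightarrow> length as = n \<Longrightarrow> set as \<subseteq> carrier A \<Longrightarrow>
           h (opr A n f as) = opr B n f (map h as)"
  shows "h \<in> cinf_hom A B"
  using assms by (simp add: cinf_hom_def)

lemma cinf_hom_closed: "h \<in> cinf_hom A B \<Longrightarrow> a \<in> carrier A \<Longrightarrow> h a \<in> carrier B"
  by (auto simp: cinf_hom_def)

lemma cinf_hom_opr:
  assumes "h \<in> cinf_hom A B" "smooth n f" "length as = n" "set as \<subseteq> carrier A"
  shows "h (opr A n f as) = opr B n f (map h as)"
  using assms unfolding cinf_hom_def by blast

lemma cinf_hom_map_closed: "h \<in> cinf_hom A B \<Longrightarrow> set as \<subseteq> carrier A \<Longrightarrow> set (map h as) \<subseteq> carrier B"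
  by (auto simp: cinf_hom_def)

lemma cinf_hom_compose: "h \<in> cinf_hom A B \<Longrightarrow> k \<in> cinf_hom B C \<Longrightarrow> (\<lambda>a. k (h a)) \<in> cinf_hom A C"
  by (rule cinf_homI)
    (simp_all add: cinf_hom_closed cinf_hom_opr cinf_hom_map_closed[simplified] comp_def)

lemma ring_hom_ring_cinf_hom:
  assumes "cinf_ring A" "cinf_ring B" "h \<in> cinf_hom A B"
  shows "ring_hom_ring (ring_of A) (ring_of B) h"
proof (rule ring_hom_ringI2)
  show "ring (ring_of A)" "ring (ring_of B)"
    using cring_ring_of[OF assms(1)] cring_ring_of[OF assms(2)] by (auto simp: cring_def)
  show "h \<in> ring_hom (ring_of A) (ring_of B)"
  proof (rule ring_hom_memI)
    fix a b assume "a \<in> carrier (ring_of A)" "b \<in> carrier (ring_of A)"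
    then have ab: "set [a, b] \<subseteq> carrier A" by simp
    show "h (a \<otimes>\<^bsub>ring_of A\<^esub> b) = h a \<otimes>\<^bsub>ring_of B\<^esub> h b"
      using cinf_hom_opr[OF assms(3) _ _ ab, of 2 "\<lambda>v. v ! 0 * v ! 1"]
      by (simp add: ring_of_def smooth_mult smooth_nth)
    show "h (a \<oplus>\<^bsub>ring_of A\<^esub> b) = h a \<oplus>\<^bsub>ring_of B\<^esub> h b"
      using cinf_hom_opr[OF assms(3) _ _ ab, of 2 "\<lambda>v. v ! 0 + v ! 1"]
      by (simp add: ring_of_def smooth_add smooth_nth)
  next
    show "h \<one>\<^bsub>ring_of A\<^esub> = \<one>\<^bsub>ring_of B\<^esub>"
      using cinf_hom_opr[OF assms(3), of 0 "\<lambda>_. 1" "[]"] by (simp add: ring_of_def smooth_const)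
  qed (use cinf_hom_closed[OF assms(3)] in simp)
qed


section \<open>Coverings by homomorphisms\<close>

text \<open>All operations are finitary, so finite lists of elements are all that has to be lifted. For a
quotient or an isomorphic copy one surjective homomorphism is enough; in a sequential colimit each
list lifts to some stage, while no single stage need cover everything.\<close>

definition cinf_cover :: "('i \<Rightarrow> 'a cinf) \<Rightarrow> ('i \<Rightarrow> 'a \<Rightarrow> 'b) \<Rightarrow> 'b cinf \<Rightarrow> bool" where
  "cinf_cover S p Q \<longleftrightarrow>
     (\<forall>i. cinf_ring (S i) \<and> p i \<in> cinf_hom (S i) Q) \<and>
     (\<forall>Xs. set Xs \<subseteq> carrier Q \<longrightarrow> (\<exists>i as. set as \<subseteq> carrier (S i) \<and> Xs = map (p i) as))"

lemma cinf_coverE: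
  assumes "cinf_cover S p Q" "set Xs \<subseteq> carrier Q"
  obtains i as where "set as \<subseteq> carrier (S i)" "Xs = map (p i) as"
  using assms by (auto simp: cinf_cover_def)

lemma cinf_cover_elemE:
  assumes "cinf_cover S p Q" "x \<in> carrier Q"
  obtains i a where "a \<in> carrier (S i)" "x = p i a"
proof -
  have "set [x] \<subseteq> carrier Q" using assms(2) by simp
  with assms(1) obtain i as where "set as \<subseteq> carrier (S i)" "[x] = map (p i) as"
    by (rule cinf_coverE)
  then show thesis using that by auto
qed

lemma cinf_coverD:
  assumes "cinf_cover S p Q"
  shows "cinf_ring (S i)" "p i \<in> cinf_hom (S i) Q"
  using assms by (auto simp: cinf_cover_def)

lemma cinf_cover_surj:
  assumes "cinf_ring A" "p \<in> cinf_hom A Q" "carrier Q \<subseteq> p ` carrier A"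
  shows "cinf_cover (\<lambda>_::unit. A) (\<lambda>_. p) Q"
proof -
  have "\<exists>as. set as \<subseteq> carrier A \<and> Xs = map p as" if "set Xs \<subseteq> carrier Q" for Xs
    using that
  proof (induction Xs)
    case (Cons X Xs)
    then obtain as where "set as \<subseteq> carrier A" "Xs = map p as" by auto
    moreover obtain a where "a \<in> carrier A" "X = p a" using Cons.prems assms(3) by auto
    ultimately show ?case by (intro exI[of _ "a # as"]) simp
  qed simp
  with assms(1,2) show ?thesis by (simp add: cinf_cover_def)
qed

text \<open>Every instance of an axiom involves one finite list of arguments. Lifted to some \<open>S i\<close>, the
instance holds there, and \<open>p i\<close> transports it to \<open>Q\<close>.\<close>

lemma cinf_ring_cover:
  assumes cov: "cinf_cover S p Q"
  shows "cinf_ring Q"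
  unfolding cinf_ring_def
proof (intro conjI allI impI; elim conjE)
  fix n f Xs assume f: "smooth n f" and len: "length Xs = n" and Xs: "set Xs \<subseteq> carrier Q"
  obtain i as where as: "set as \<subseteq> carrier (S i)" "Xs = map (p i) as"
    by (rule cinf_coverE[OF cov Xs])
  have "p i (opr (S i) n f as) = opr Q n f Xs"
    using cinf_hom_opr[OF cinf_coverD(2)[OF cov] f _ as(1)] as(2) len by simp
  moreover have "p i (opr (S i) n f as) \<in> carrier Q"
    using cinf_hom_closed[OF cinf_coverD(2)[OF cov]] opr_closed[OF cinf_coverD(1)[OF cov] f _ as(1)] as(2) len
    by simp
  ultimately show "opr Q n f Xs \<in> carrier Q" by simp
next
  fix n j Xs assume j: "j < n" and len: "length Xs = n" and Xs: "set Xs \<subseteq> carrier Q"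
  obtain i as where as: "set as \<subseteq> carrier (S i)" "Xs = map (p i) as"
    by (rule cinf_coverE[OF cov Xs])
  show "opr Q n (\<lambda>v. v ! j) Xs = Xs ! j"
    using cinf_hom_opr[OF cinf_coverD(2)[OF cov] smooth_nth[OF j] _ as(1)] as(2) len j
      opr_nth[OF cinf_coverD(1)[OF cov] j _ as(1)] by simp
next
  fix n m f gs Xs
  assume f: "smooth m f" and gs: "length gs = m" "\<forall>g\<in>set gs. smooth n g"
    and len: "length Xs = n" and Xs: "set Xs \<subseteq> carrier Q"
  obtain i as where as: "set as \<subseteq> carrier (S i)" "Xs = map (p i) as"
    by (rule cinf_coverE[OF cov Xs])
  have len': "length as = n" using len as(2) by simp
  note S = cinf_coverD(1)[OF cov, of i] and p = cinf_coverD(2)[OF cov, of i]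
  have "opr Q n (\<lambda>v. f (map (\<lambda>g. g v) gs)) Xs = p i (opr (S i) n (\<lambda>v. f (map (\<lambda>g. g v) gs)) as)"
    unfolding as(2) by (rule cinf_hom_opr[OF p _ len' as(1), symmetric], rule smooth_compose[OF f gs(1)])
      (use gs in auto)
  also have "opr (S i) n (\<lambda>v. f (map (\<lambda>g. g v) gs)) as = opr (S i) m f (map (\<lambda>g. opr (S i) n g as) gs)"
    by (rule opr_compose[OF S f gs(1) _ len' as(1)]) (use gs in auto)
  also have "p i \<dots> = opr Q m f (map (p i) (map (\<lambda>g. opr (S i) n g as) gs))"
    by (rule cinf_hom_opr[OF p f]) (use gs opr_closed[OF S _ len' as(1)] in auto)
  also have "map (p i) (map (\<lambda>g. opr (S i) n g as) gs) = map (\<lambda>g. opr Q n g Xs) gs"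
    using gs(2) cinf_hom_opr[OF p _ len' as(1)] by (simp add: as(2))
  finally show "opr Q n (\<lambda>v. f (map (\<lambda>g. g v) gs)) Xs = opr Q m f (map (\<lambda>g. opr Q n g Xs) gs)" .
qed

text \<open>The map induced on elements respects an operation because the arguments lift simultaneously to
one \<open>S i\<close>, where \<open>h i\<close> respects it.\<close>

lemma cinf_cover_lift:
  assumes cov: "cinf_cover S p Q"
    and h: "\<And>i. h i \<in> cinf_hom (S i) V"
    and wd: "\<And>i j a b. a \<in> carrier (S i) \<Longrightarrow> b \<in> carrier (S j) \<Longrightarrow> p i a = p j b \<Longrightarrow> h i a = h j b"
  obtains g where "g \<in> cinf_hom Q V" "\<And>i a. a \<in> carrier (S i) \<Longrightarrow> g (p i a) = h i a"
proof -
  define g where "g x = (SOME y. \<exists>i a. a \<in> carrier (S i) \<and> x = p i a \<and> y = h i a)" for x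
  have g: "g (p i a) = h i a" if "a \<in> carrier (S i)" for i a
    unfolding g_def by (rule some_equality) (use that wd in metis)+
  have "g \<in> cinf_hom Q V"
  proof (rule cinf_homI)
    fix x assume "x \<in> carrier Q"
    then obtain i a where "a \<in> carrier (S i)" "x = p i a"
      by (rule cinf_cover_elemE[OF cov])
    then show "g x \<in> carrier V" using g cinf_hom_closed[OF h] by simp
  next
    fix n f Xs assume f: "smooth n f" and len: "length Xs = n" and Xs: "set Xs \<subseteq> carrier Q"
    obtain i as where as: "set as \<subseteq> carrier (S i)" "Xs = map (p i) as"
      by (rule cinf_coverE[OF cov Xs])
    have len': "length as = n" using len as(2) by simp
    have "g (opr Q n f Xs) = g (p i (opr (S i) n f as))"
      using cinf_hom_opr[OF cinf_coverD(2)[OF cov] f len' as(1)] as(2) by simp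
    also have "\<dots> = h i (opr (S i) n f as)"
      by (rule g[OF opr_closed[OF cinf_coverD(1)[OF cov] f len' as(1)]])
    also have "\<dots> = opr V n f (map (h i) as)"
      by (rule cinf_hom_opr[OF h f len' as(1)])
    also have "map (h i) as = map g Xs"
      using as g by auto
    finally show "g (opr Q n f Xs) = opr V n f (map g Xs)" .
  qed
  then show thesis using g that by blast
qed

lemma cinf_cover_hom_eq:
  assumes "cinf_cover S p Q" and "\<And>i a. a \<in> carrier (S i) \<Longrightarrow> g (p i a) = g' (p i a)"
    and "x \<in> carrier Q"
  shows "g x = g' x"
  using assms(1,3) by (rule cinf_cover_elemE) (use assms(2) in simp)


section \<open>Quotients\<close>

text \<open>Hadamard's lemma is an identity between smooth functions of \<open>n + 1\<close> variables. Evaluated at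
\<open>as\<close> followed by \<open>b\<close>, it exhibits the difference of the two values of \<open>f\<close> as a multiple of
\<open>b - as\<^sub>i\<close>, which lies in the ideal.\<close>

lemma opr_coset_update:
  assumes A: "cinf_ring A" and I: "ideal I (ring_of A)" and f: "smooth n f"
    and as: "length as = n" "set as \<subseteq> carrier A" and i: "i < n" and b: "b \<in> carrier A"
    and eq: "I +>\<^bsub>ring_of A\<^esub> b = I +>\<^bsub>ring_of A\<^esub> as ! i"
  shows "I +>\<^bsub>ring_of A\<^esub> opr A n f (as[i := b]) = I +>\<^bsub>ring_of A\<^esub> opr A n f as"
proof -
  interpret cring "ring_of A" by (rule cring_ring_of[OF A])
  interpret I: ideal I "ring_of A" by (rule I)
  obtain h where h: "smooth (Suc n) h"
    "\<And>v s. length v = n \<Longrightarrow> f (v[i := s]) - f v = (s - v ! i) * h (v @ [s])"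
    using Hadamard_lemma[OF f i] by metis
  let ?bs = "as @ [b]"
  have bs: "length ?bs = Suc n" "set ?bs \<subseteq> carrier A" using as b by auto
  have asi: "as ! i \<in> carrier A" using as i by auto
  have sm_upd: "smooth (Suc n) (\<lambda>w. (take n w)[i := w ! n] ! j)" if "j < n" for j
  proof (rule smooth_congI)
    show "smooth (Suc n) (\<lambda>w. w ! (if j = i then n else j))" using that by (intro smooth_nth) simp
    show "w ! (if j = i then n else j) = (take n w)[i := w ! n] ! j" if "length w = Suc n" for w :: "real list"
      using that \<open>j < n\<close> by simp
  qed
  have sm_take: "smooth (Suc n) (\<lambda>w. take n w ! j)" if "j < n" for j
    using that by (simp add: smooth_nth)
  have upd: "opr A (Suc n) (\<lambda>w. f ((take n w)[i := w ! n])) ?bs = opr A n f (as[i := b])"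
  proof -
    have "opr A (Suc n) (\<lambda>w. (take n w)[i := w ! n] ! j) ?bs = as[i := b] ! j" if "j < n" for j
    proof -
      have "opr A (Suc n) (\<lambda>w. (take n w)[i := w ! n] ! j) ?bs
          = opr A (Suc n) (\<lambda>w. w ! (if j = i then n else j)) ?bs"
        using that by (intro opr_cong[OF A sm_upd bs]) auto
      also have "\<dots> = as[i := b] ! j"
        using that as i by (subst opr_nth[OF A _ bs]) (auto simp: nth_append)
      finally show ?thesis .
    qed
    then have "map (\<lambda>j. opr A (Suc n) (\<lambda>w. (take n w)[i := w ! n] ! j) ?bs) [0..<n] = as[i := b]"
      using as by (auto simp: list_eq_iff_nth_eq)
    with opr_compose_nth[OF A f sm_upd _ bs] show ?thesis by simp
  qed
  have take: "opr A (Suc n) (\<lambda>w. f (take n w)) ?bs = opr A n f as"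
  proof -
    have "opr A (Suc n) (\<lambda>w. take n w ! j) ?bs = as ! j" if "j < n" for j
      using opr_nth[OF A _ bs, of j] that as by (simp add: nth_append)
    then have "map (\<lambda>j. opr A (Suc n) (\<lambda>w. take n w ! j) ?bs) [0..<n] = as"
      using as by (auto simp: list_eq_iff_nth_eq)
    with opr_compose_nth[OF A f sm_take _ bs] show ?thesis by simp
  qed
  have s1: "smooth (Suc n) (\<lambda>w. f ((take n w)[i := w ! n]))"
    by (rule smooth_compose_nth[OF f sm_upd]) simp_all
  have s2: "smooth (Suc n) (\<lambda>w. f (take n w))"
    by (rule smooth_compose_nth[OF f sm_take]) simp_all
  have s3: "smooth (Suc n) (\<lambda>w. w ! n)" "smooth (Suc n) (\<lambda>w. w ! i)"
    using i by (auto intro: smooth_nth)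
  have "opr A n f (as[i := b]) \<ominus>\<^bsub>ring_of A\<^esub> opr A n f as
      = opr A (Suc n) (\<lambda>w. f ((take n w)[i := w ! n]) - f (take n w)) ?bs"
    by (simp only: opr_diff[OF A s1 s2 bs] upd take)
  also have "\<dots> = opr A (Suc n) (\<lambda>w. (w ! n - w ! i) * h w) ?bs"
  proof (rule opr_cong[OF A smooth_diff[OF s1 s2] bs])
    show "f ((take n w)[i := w ! n]) - f (take n w) = (w ! n - w ! i) * h w" if "length w = Suc n" for w
    proof -
      have "take n w @ [w ! n] = w"
        using that by (metis lessI take_Suc_conv_app_nth take_all_iff order_refl)
      with h(2)[of "take n w" "w ! n"] i that show ?thesis by simp
    qed
  qed
  also have "\<dots> = (b \<ominus>\<^bsub>ring_of A\<^esub> as ! i) \<otimes>\<^bsub>ring_of A\<^esub> opr A (Suc n) h ?bs"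
    using i as by (simp add: opr_mult[OF A smooth_diff[OF s3] h(1) bs] opr_diff[OF A s3 bs]
        opr_nth[OF A _ bs] nth_append)
  also have "\<dots> \<in> I"
    using quotient_eq_iff_same_a_r_cos[OF I, of b "as ! i"] b asi eq opr_closed[OF A h(1) bs]
    by (simp add: I.I_r_closed)
  finally have mem: "opr A n f (as[i := b]) \<ominus>\<^bsub>ring_of A\<^esub> opr A n f as \<in> I" .
  have "set (as[i := b]) \<subseteq> carrier A"
    using as b set_update_subset_insert[of as i b] by blast
  then have "opr A n f (as[i := b]) \<in> carrier A" "opr A n f as \<in> carrier A"
    using opr_closed[OF A f] as by simp_all
  then show ?thesis
    using quotient_eq_iff_same_a_r_cos[OF I] mem by simp
qed

text \<open>Exchanging the arguments one after another shows that a ring ideal is a congruence for all smooth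
operations. In the induction, \<open>ps\<close> collects the arguments that have been exchanged already.\<close>

lemma opr_coset_cong:
  assumes A: "cinf_ring A" and I: "ideal I (ring_of A)" and f: "smooth n f"
    and len: "length as = n" and as: "set as \<subseteq> carrier A" and bs: "set bs \<subseteq> carrier A"
    and eq: "map ((+>\<^bsub>ring_of A\<^esub>) I) as = map ((+>\<^bsub>ring_of A\<^esub>) I) bs"
  shows "I +>\<^bsub>ring_of A\<^esub> opr A n f as = I +>\<^bsub>ring_of A\<^esub> opr A n f bs"
proof -
  have "I +>\<^bsub>ring_of A\<^esub> opr A n f (ps @ as) = I +>\<^bsub>ring_of A\<^esub> opr A n f (ps @ bs)"
    if "length (ps @ as) = n" "set (ps @ as) \<subseteq> carrier A" "set bs \<subseteq> carrier A"
      "map ((+>\<^bsub>ring_of A\<^esub>) I) as = map ((+>\<^bsub>ring_of A\<^esub>) I) bs" for ps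
    using map_eq_imp_length_eq[OF that(4)] that
  proof (induction as bs arbitrary: ps rule: list_induct2)
    case (Cons a as b bs)
    have "I +>\<^bsub>ring_of A\<^esub> opr A n f ((ps @ a # as)[length ps := b]) = I +>\<^bsub>ring_of A\<^esub> opr A n f (ps @ a # as)"
      by (rule opr_coset_update[OF A I f]) (use Cons.prems in auto)
    moreover have "I +>\<^bsub>ring_of A\<^esub> opr A n f ((ps @ [b]) @ as) = I +>\<^bsub>ring_of A\<^esub> opr A n f ((ps @ [b]) @ bs)"
      by (rule Cons.IH) (use Cons.prems in auto)
    ultimately show ?case by simp
  qed simp
  from this[of "[]"] assms show ?thesis by simp
qed

lemma in_listset_iff: "xs \<in> listset Xs \<longleftrightarrow> list_all2 (\<in>) xs Xs"
  by (induction Xs arbitrary: xs) (auto simp: set_Cons_def list_all2_Cons2)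

lemma carrier_cinf_quot: "carrier (cinf_quot A I) = (\<lambda>a. I +>\<^bsub>ring_of A\<^esub> a) ` carrier A"
  by (auto simp: cinf_quot_def FactRing_def A_RCOSETS_def' a_r_coset_def' ring_of_def)

text \<open>The operation on cosets is a union over all choices of representatives; by the congruence
property all choices yield the same coset.\<close>

lemma quot_proj_hom:
  assumes A: "cinf_ring A" and I: "ideal I (ring_of A)"
  shows "(\<lambda>a. I +>\<^bsub>ring_of A\<^esub> a) \<in> cinf_hom A (cinf_quot A I)"
proof (rule cinf_homI)
  interpret cring "ring_of A" by (rule cring_ring_of[OF A])
  interpret I: ideal I "ring_of A" by (rule I)
  fix n f as assume f: "smooth n f" and as: "length as = n" "set as \<subseteq> carrier A"
  let ?p = "\<lambda>a. I +>\<^bsub>ring_of A\<^esub> a"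
  have "?p (opr A n f bs) = ?p (opr A n f as)" if "bs \<in> listset (map ?p as)" for bs
  proof -
    have *: "list_all2 (\<lambda>b a. b \<in> ?p a) bs as"
      using that by (simp add: in_listset_iff list_all2_map2)
    have rep: "b \<in> carrier A \<and> ?p b = ?p a" if "a \<in> carrier A" "b \<in> ?p a" for a b
      using I.a_elemrcos_carrier[of a b] I.a_repr_independence'[of b a] that by simp
    have len: "length bs = length as"
      using * by (rule list_all2_lengthD)
    have nth: "bs ! j \<in> carrier A \<and> ?p (bs ! j) = ?p (as ! j)" if "j < length as" for j
      by (rule rep) (use * as(2) that len in \<open>auto simp: list_all2_conv_all_nth\<close>)
    have "set bs \<subseteq> carrier A"
      using nth len by (metis in_set_conv_nth subsetI)
    moreover have "map ?p as = map ?p bs"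
      using nth len by (simp add: list_eq_iff_nth_eq)
    ultimately show ?thesis by (intro opr_coset_cong[OF A I f as, symmetric])
  qed
  moreover have "as \<in> listset (map ?p as)"
    using as(2) I.a_rcos_self by (force simp: in_listset_iff list_all2_conv_all_nth)
  ultimately have "(\<Union>bs\<in>listset (map ?p as). ?p (opr A n f bs)) = ?p (opr A n f as)" by blast
  then show "?p (opr A n f as) = opr (cinf_quot A I) n f (map ?p as)"
    by (simp add: cinf_quot_def)
qed (simp add: carrier_cinf_quot)

lemma quot_cover:
  assumes "cinf_ring A" "ideal I (ring_of A)"
  shows "cinf_cover (\<lambda>_::unit. A) (\<lambda>_ a. I +>\<^bsub>ring_of A\<^esub> a) (cinf_quot A I)"
  by (rule cinf_cover_surj[OF assms(1) quot_proj_hom[OF assms]]) (simp add: carrier_cinf_quot)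

text \<open>The kernel of \<open>h\<close> is an ideal that contains the generators of \<open>I\<close>, hence contains \<open>I\<close>.\<close>

lemma quot_lift:
  assumes A: "cinf_ring A" and V: "cinf_ring V" and S: "S \<subseteq> carrier A"
    and I: "I = genideal (ring_of A) S"
    and h: "h \<in> cinf_hom A V" and kill: "\<And>s. s \<in> S \<Longrightarrow> h s = \<zero>\<^bsub>ring_of V\<^esub>"
  obtains g where "g \<in> cinf_hom (cinf_quot A I) V"
    "\<And>a. a \<in> carrier A \<Longrightarrow> g (I +>\<^bsub>ring_of A\<^esub> a) = h a"
proof -
  interpret cring "ring_of A" by (rule cring_ring_of[OF A])
  interpret V: cring "ring_of V" by (rule cring_ring_of[OF V])
  interpret h: ring_hom_ring "ring_of A" "ring_of V" h by (rule ring_hom_ring_cinf_hom[OF A V h])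
  have idl: "ideal I (ring_of A)" unfolding I by (rule genideal_ideal) (simp add: S)
  have ker: "s \<in> a_kernel (ring_of A) (ring_of V) h \<longleftrightarrow> s \<in> carrier A \<and> h s = \<zero>\<^bsub>ring_of V\<^esub>" for s
    unfolding a_kernel_def' mem_Collect_eq ring_of_carrier ..
  have "S \<subseteq> a_kernel (ring_of A) (ring_of V) h"
    using S kill ker by blast
  then have I_ker: "I \<subseteq> a_kernel (ring_of A) (ring_of V) h"
    unfolding I by (rule genideal_minimal[OF h.kernel_is_ideal])
  have wd: "h a = h b" if "a \<in> carrier A" "b \<in> carrier A" "I +>\<^bsub>ring_of A\<^esub> a = I +>\<^bsub>ring_of A\<^esub> b" for a b
  proof -
    have "a \<ominus>\<^bsub>ring_of A\<^esub> b \<in> I"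
      using quotient_eq_iff_same_a_r_cos[OF idl, of a b] that by simp
    with I_ker ker have "h (a \<ominus>\<^bsub>ring_of A\<^esub> b) = \<zero>\<^bsub>ring_of V\<^esub>" by blast
    moreover have "a \<in> carrier (ring_of A)" "b \<in> carrier (ring_of A)"
      using that by simp_all
    ultimately show ?thesis
      using V.add.inv_solve_right[of "\<zero>\<^bsub>ring_of V\<^esub>" "h a" "h b"]
      by (simp add: a_minus_def del: ring_of_carrier)
  qed
  show thesis
  proof (rule cinf_cover_lift[OF quot_cover[OF A idl], of "\<lambda>_. h" V, OF h wd])
    fix g
    assume g: "g \<in> cinf_hom (cinf_quot A I) V"
      "\<And>(i::unit) a. a \<in> carrier A \<Longrightarrow> g (I +>\<^bsub>ring_of A\<^esub> a) = h a"
    show thesis by (rule that[OF g(1)]) (rule g(2))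
  qed
qed


lemma cinf_hom_minus_eq_zero:
  assumes "cinf_ring A" "cinf_ring V" "h \<in> cinf_hom A V" "a \<in> carrier A" "b \<in> carrier A" "h a = h b"
  shows "h (a \<ominus>\<^bsub>ring_of A\<^esub> b) = \<zero>\<^bsub>ring_of V\<^esub>"
proof -
  interpret h: ring_hom_ring "ring_of A" "ring_of V" h
    by (rule ring_hom_ring_cinf_hom[OF assms(1-3)])
  have "a \<in> carrier (ring_of A)" "b \<in> carrier (ring_of A)"
    using assms(4,5) by simp_all
  then show ?thesis
    using assms(6) by (simp add: a_minus_def h.S.r_neg del: ring_of_carrier)
qed

text \<open>The relations of a presentation hold in the quotient.\<close>

lemma coset_eq_if_minus_generator:
  assumes A: "cinf_ring A" and S: "S \<subseteq> carrier A" and ab: "a \<in> carrier A" "b \<in> carrier A"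
    and mem: "a \<ominus>\<^bsub>ring_of A\<^esub> b \<in> S"
  shows "genideal (ring_of A) S +>\<^bsub>ring_of A\<^esub> a = genideal (ring_of A) S +>\<^bsub>ring_of A\<^esub> b"
proof -
  interpret cring "ring_of A" by (rule cring_ring_of[OF A])
  have "ideal (genideal (ring_of A) S) (ring_of A)"
    by (rule genideal_ideal) (simp add: S)
  moreover have "a \<ominus>\<^bsub>ring_of A\<^esub> b \<in> genideal (ring_of A) S"
    using genideal_self[of S] S mem by auto
  ultimately show ?thesis
    using quotient_eq_iff_same_a_r_cos ab by (metis ring_of_carrier)
qed

lemma minus_closed_ring_of:
  "cinf_ring A \<Longrightarrow> a \<in> carrier A \<Longrightarrow> b \<in> carrier A \<Longrightarrow> a \<ominus>\<^bsub>ring_of A\<^esub> b \<in> carrier A"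
  using ring.ring_simprules(4)[OF cring.axioms(1)[OF cring_ring_of], of A a b] by simp

lemma mult_closed_ring_of:
  "cinf_ring A \<Longrightarrow> a \<in> carrier A \<Longrightarrow> b \<in> carrier A \<Longrightarrow> a \<otimes>\<^bsub>ring_of A\<^esub> b \<in> carrier A"
  using ring.ring_simprules(5)[OF cring.axioms(1)[OF cring_ring_of], of A a b] by simp

lemma genideal_ideal_ring_of:
  "cinf_ring A \<Longrightarrow> S \<subseteq> carrier A \<Longrightarrow> ideal (genideal (ring_of A) S) (ring_of A)"
  using ring.genideal_ideal[OF cring.axioms(1)[OF cring_ring_of], of A S] by simp


section \<open>Free rings\<close>

lemma in_carrier_cinf_freeI:
  "smooth (length ss) f \<Longrightarrow> set ss \<subseteq> S \<Longrightarrow> (\<lambda>x. f (map x ss)) \<in> carrier (cinf_free S)"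
  by (auto simp: cinf_free_def)

lemma in_carrier_cinf_freeE:
  assumes "F \<in> carrier (cinf_free S)"
  obtains f ss where "smooth (length ss) f" "set ss \<subseteq> S" "F = (\<lambda>x. f (map x ss))"
  using assms by (auto simp: cinf_free_def)

lemma opr_cinf_free: "opr (cinf_free S) n f Fs = (\<lambda>x. f (map (\<lambda>F. F x) Fs))"
  by (simp add: cinf_free_def)

text \<open>Finitely many elements of a free ring depend on a common finite list of variables, namely the
concatenation of their lists of variables.\<close>

lemma cinf_free_common_variables:
  assumes "set Fs \<subseteq> carrier (cinf_free S)"
  obtains ss gs where "set ss \<subseteq> S" "\<forall>g\<in>set gs. smooth (length ss) g"
    "Fs = map (\<lambda>g x. g (map x ss)) gs"
proof -
  have "\<exists>ss gs. set ss \<subseteq> S \<and> (\<forall>g\<in>set gs. smooth (length ss) g) \<and> Fs = map (\<lambda>g x. g (map x ss)) gs"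
    using assms
  proof (induction Fs)
    case Nil
    then show ?case by (intro exI[of _ "[]"]) simp
  next
    case (Cons F Fs)
    then obtain ts gs where ts: "set ts \<subseteq> S" and gs: "\<forall>g\<in>set gs. smooth (length ts) g"
      and Fs: "Fs = map (\<lambda>g x. g (map x ts)) gs" by auto
    have "F \<in> carrier (cinf_free S)" using Cons.prems by simp
    then obtain f ss where f: "smooth (length ss) f" and ss: "set ss \<subseteq> S" and F: "F = (\<lambda>x. f (map x ss))"
      by (rule in_carrier_cinf_freeE)
    let ?f = "\<lambda>v. f (take (length ss) v)" and ?gs = "map (\<lambda>g v. g (drop (length ss) v)) gs"
    have "smooth (length (ss @ ts)) ?f"
    proof (rule smooth_compose_nth[OF f])
      show "smooth (length (ss @ ts)) (\<lambda>v. take (length ss) v ! j)" if "j < length ss" for j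
        using that by (simp add: smooth_nth)
    qed simp
    moreover have "smooth (length (ss @ ts)) (\<lambda>v. g (drop (length ss) v))" if "g \<in> set gs" for g
    proof (rule smooth_compose_nth[of "length ts"])
      show "smooth (length (ss @ ts)) (\<lambda>v. drop (length ss) v ! j)" if "j < length ts" for j
      proof (rule smooth_congI)
        show "smooth (length (ss @ ts)) (\<lambda>v. v ! (length ss + j))"
          using that by (intro smooth_nth) simp
      qed simp
    qed (use gs that in auto)
    moreover have "F # Fs = map (\<lambda>g x. g (map x (ss @ ts))) (?f # ?gs)"
      by (simp add: F Fs)
    ultimately show ?case using ss ts
      by (intro exI[of _ "ss @ ts"] exI[of _ "?f # ?gs"]) auto
  qed
  then show thesis using that by blast
qed

lemma cinf_ring_free: "cinf_ring (cinf_free S)"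
  unfolding cinf_ring_def
proof (intro conjI allI impI; elim conjE)
  fix n f Fs assume f: "smooth n f" and len: "length Fs = n" and Fs: "set Fs \<subseteq> carrier (cinf_free S)"
  from Fs obtain ss gs where ss: "set ss \<subseteq> S" and gs: "\<forall>g\<in>set gs. smooth (length ss) g"
    and eq: "Fs = map (\<lambda>g x. g (map x ss)) gs" by (rule cinf_free_common_variables)
  have "(\<lambda>x. (\<lambda>v. f (map (\<lambda>g. g v) gs)) (map x ss)) \<in> carrier (cinf_free S)"
    by (rule in_carrier_cinf_freeI[OF smooth_compose[OF f _ gs[rule_format]] ss]) (use len eq in simp_all)
  then show "opr (cinf_free S) n f Fs \<in> carrier (cinf_free S)"
    by (simp add: opr_cinf_free eq comp_def)
qed (simp_all add: opr_cinf_free comp_def)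

lemma free_gen_closed: "s \<in> S \<Longrightarrow> free_gen s \<in> carrier (cinf_free S)"
  using in_carrier_cinf_freeI[of "[s]" "\<lambda>v. v ! 0" S] by (simp add: free_gen_def smooth_nth)

text \<open>Every element is a smooth operation applied to generators; hence homomorphisms are determined by
their values on generators.\<close>

lemma cinf_free_generated:
  "(\<lambda>x. f (map x ss)) = opr (cinf_free S) (length ss) f (map free_gen ss)"
  by (simp add: opr_cinf_free free_gen_def comp_def)

lemma cinf_free_hom_eq:
  assumes g: "g \<in> cinf_hom (cinf_free S) V" and g': "g' \<in> cinf_hom (cinf_free S) V"
    and eq: "\<And>s. s \<in> S \<Longrightarrow> g (free_gen s) = g' (free_gen s)" and F: "F \<in> carrier (cinf_free S)"
  shows "g F = g' F"
proof -
  obtain f ss where f: "smooth (length ss) f" and ss: "set ss \<subseteq> S" and F': "F = (\<lambda>x. f (map x ss))"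
    using F by (rule in_carrier_cinf_freeE)
  have *: "length (map free_gen ss) = length ss" "set (map free_gen ss) \<subseteq> carrier (cinf_free S)"
    using ss free_gen_closed[of _ S] by auto
  have "map g (map free_gen ss) = map g' (map free_gen ss)"
    using eq ss by auto
  then show ?thesis
    unfolding F' cinf_free_generated[of f ss S]
    by (simp only: cinf_hom_opr[OF g f *] cinf_hom_opr[OF g' f *])
qed

text \<open>This makes the extension of \<open>\<phi>\<close> to the free ring well defined. Both representations are
rewritten as operations on the joint list of variables \<open>ss @ ts\<close>, where \<open>pos s\<close> is an index at which
\<open>s\<close> occurs. At a point \<open>v\<close> the two rewritten functions are the original ones at the assignment
\<open>s \<mapsto> v ! pos s\<close>, so they agree even if variables are repeated.\<close>

lemma opr_free_representation_cong:
  assumes V: "cinf_ring V" and \<phi>: "\<phi> ` S \<subseteq> carrier V"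
    and f: "smooth (length ss) f" "set ss \<subseteq> S" and g: "smooth (length ts) g" "set ts \<subseteq> S"
    and eq: "(\<lambda>x. f (map x ss)) = (\<lambda>x. g (map x ts))"
  shows "opr V (length ss) f (map \<phi> ss) = opr V (length ts) g (map \<phi> ts)"
proof -
  let ?us = "ss @ ts" and ?n = "length (ss @ ts)"
  have "\<forall>s\<in>set ?us. \<exists>i. i < ?n \<and> ?us ! i = s" by (metis in_set_conv_nth)
  then obtain pos where pos: "\<And>s. s \<in> set ?us \<Longrightarrow> pos s < ?n \<and> ?us ! pos s = s" by metis
  have us: "length (map \<phi> ?us) = ?n" "set (map \<phi> ?us) \<subseteq> carrier V"
    using f(2) g(2) \<phi> by auto
  have sm: "smooth ?n (\<lambda>v. v ! pos s)" if "s \<in> set ?us" for s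
    using pos[OF that] by (blast intro: smooth_nth)
  have *: "smooth ?n (\<lambda>v. h (map (\<lambda>s. v ! pos s) rs))"
    "opr V ?n (\<lambda>v. h (map (\<lambda>s. v ! pos s) rs)) (map \<phi> ?us) = opr V (length rs) h (map \<phi> rs)"
    if h: "smooth (length rs) h" and rs: "set rs \<subseteq> set ?us" for h rs
  proof -
    let ?gs = "map (\<lambda>s v. v ! pos s) rs"
    have len: "length ?gs = length rs" by simp
    have gs: "smooth ?n k" if "k \<in> set ?gs" for k using that sm rs by auto
    have "opr V ?n (\<lambda>v. h (map (\<lambda>k. k v) ?gs)) (map \<phi> ?us)
        = opr V (length rs) h (map (\<lambda>k. opr V ?n k (map \<phi> ?us)) ?gs)"
      by (rule opr_compose[OF V h len gs us])
    also have "map (\<lambda>k. opr V ?n k (map \<phi> ?us)) ?gs = map \<phi> rs"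
    proof -
      have "opr V ?n (\<lambda>v. v ! pos s) (map \<phi> ?us) = \<phi> s" if "s \<in> set rs" for s
      proof -
        have p: "pos s < ?n" "?us ! pos s = s" using pos[of s] that rs by auto
        have "opr V ?n (\<lambda>v. v ! pos s) (map \<phi> ?us) = map \<phi> ?us ! pos s"
          by (rule opr_nth[OF V p(1) us])
        also have "\<dots> = \<phi> (?us ! pos s)" by (rule nth_map[OF p(1)])
        finally show ?thesis by (simp only: p(2))
      qed
      then show ?thesis by simp
    qed
    finally show "opr V ?n (\<lambda>v. h (map (\<lambda>s. v ! pos s) rs)) (map \<phi> ?us) = opr V (length rs) h (map \<phi> rs)"
      unfolding map_map comp_def .
    show "smooth ?n (\<lambda>v. h (map (\<lambda>s. v ! pos s) rs))"
      using smooth_compose[OF h len gs] by (simp add: comp_def)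
  qed
  have "opr V ?n (\<lambda>v. f (map (\<lambda>s. v ! pos s) ss)) (map \<phi> ?us)
      = opr V ?n (\<lambda>v. g (map (\<lambda>s. v ! pos s) ts)) (map \<phi> ?us)"
    using fun_cong[OF eq] by simp
  then show ?thesis
    using *(2)[OF f(1)] *(2)[OF g(1)] by simp
qed

lemma cinf_free_lift:
  assumes V: "cinf_ring V" and \<phi>: "\<phi> ` S \<subseteq> carrier V"
  obtains g where "g \<in> cinf_hom (cinf_free S) V" "\<forall>s\<in>S. g (free_gen s) = \<phi> s"
proof -
  define g where "g F = (SOME y. \<exists>f ss. smooth (length ss) f \<and> set ss \<subseteq> S \<and>
      F = (\<lambda>x. f (map x ss)) \<and> y = opr V (length ss) f (map \<phi> ss))" for F
  have g: "g (\<lambda>x. f (map x ss)) = opr V (length ss) f (map \<phi> ss)"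
    if "smooth (length ss) f" "set ss \<subseteq> S" for f ss
    unfolding g_def
  proof (rule some_equality)
    show "\<exists>f' ts. smooth (length ts) f' \<and> set ts \<subseteq> S \<and> (\<lambda>x. f (map x ss)) = (\<lambda>x. f' (map x ts)) \<and>
        opr V (length ss) f (map \<phi> ss) = opr V (length ts) f' (map \<phi> ts)"
      using that by blast
    fix y assume "\<exists>f' ts. smooth (length ts) f' \<and> set ts \<subseteq> S \<and> (\<lambda>x. f (map x ss)) = (\<lambda>x. f' (map x ts)) \<and>
        y = opr V (length ts) f' (map \<phi> ts)"
    then obtain f' ts where f': "smooth (length ts) f'" "set ts \<subseteq> S"
      "(\<lambda>x. f (map x ss)) = (\<lambda>x. f' (map x ts))" "y = opr V (length ts) f' (map \<phi> ts)" by blast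
    then show "y = opr V (length ss) f (map \<phi> ss)"
      using opr_free_representation_cong[OF V \<phi> that f'(1,2,3)] by simp
  qed
  have \<phi>': "length (map \<phi> ss) = length ss" "set (map \<phi> ss) \<subseteq> carrier V" if "set ss \<subseteq> S" for ss
    using that \<phi> by auto
  show thesis
  proof (rule that)
    show "g \<in> cinf_hom (cinf_free S) V"
    proof (rule cinf_homI)
      fix F assume "F \<in> carrier (cinf_free S)"
      then obtain f ss where "smooth (length ss) f" "set ss \<subseteq> S" "F = (\<lambda>x. f (map x ss))"
        by (rule in_carrier_cinf_freeE)
      then show "g F \<in> carrier V"
        using g opr_closed[OF V _ \<phi>'] by simp
    next
      fix n f Fs assume f: "smooth n f" and len: "length Fs = n" and Fs: "set Fs \<subseteq> carrier (cinf_free S)"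
      from Fs obtain ss gs where ss: "set ss \<subseteq> S" and gs': "\<forall>k\<in>set gs. smooth (length ss) k"
        and eq: "Fs = map (\<lambda>k x. k (map x ss)) gs" by (rule cinf_free_common_variables)
      have len': "length gs = n" using len eq by simp
      note gs = gs'[rule_format]
      have "opr (cinf_free S) n f Fs = (\<lambda>x. (\<lambda>v. f (map (\<lambda>k. k v) gs)) (map x ss))"
        by (simp add: opr_cinf_free eq comp_def)
      then have "g (opr (cinf_free S) n f Fs) = opr V (length ss) (\<lambda>v. f (map (\<lambda>k. k v) gs)) (map \<phi> ss)"
        using g[OF smooth_compose[OF f len' gs] ss] by simp
      also have "\<dots> = opr V n f (map (\<lambda>k. opr V (length ss) k (map \<phi> ss)) gs)"
        by (rule opr_compose[OF V f len' gs \<phi>'[OF ss]])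
      also have "map (\<lambda>k. opr V (length ss) k (map \<phi> ss)) gs = map g Fs"
        using g[OF gs ss] by (simp add: eq)
      finally show "g (opr (cinf_free S) n f Fs) = opr V n f (map g Fs)" .
    qed
    have "g (free_gen s) = \<phi> s" if "s \<in> S" for s
      using g[of "[s]" "\<lambda>v. v ! 0"] that opr_nth[OF V _ \<phi>'[of "[s]"], of 0]
      by (simp add: free_gen_def smooth_nth)
    then show "\<forall>s\<in>S. g (free_gen s) = \<phi> s" by blast
  qed
qed


section \<open>Coproducts\<close>

text \<open>The relations are named separately from the ideal that they generate, because maps out of the
coproduct are constructed by checking them on the generators.\<close>

definition coprod_gens :: "'b cinf \<Rightarrow> 'c cinf \<Rightarrow> (('b + 'c \<Rightarrow> real) \<Rightarrow> real) set" where
  "coprod_gens B C = (let F = cinf_free (carrier B <+> carrier C) in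
       {opr F n f (map (free_gen \<circ> Inl) bs) \<ominus>\<^bsub>ring_of F\<^esub> free_gen (Inl (opr B n f bs)) | n f bs.
           smooth n f \<and> length bs = n \<and> set bs \<subseteq> carrier B} \<union>
        {opr F n f (map (free_gen \<circ> Inr) cs) \<ominus>\<^bsub>ring_of F\<^esub> free_gen (Inr (opr C n f cs)) | n f cs.
           smooth n f \<and> length cs = n \<and> set cs \<subseteq> carrier C})"

lemma coprod_rel_eq:
  "coprod_rel B C = genideal (ring_of (cinf_free (carrier B <+> carrier C))) (coprod_gens B C)"
  by (simp add: coprod_rel_def coprod_gens_def Let_def)

lemma coprod_gensI:
  fixes B :: "'b cinf" and C :: "'c cinf"
  defines "F \<equiv> cinf_free (carrier B <+> carrier C)"
  shows "smooth n f \<Longrightarrow> length bs = n \<Longrightarrow> set bs \<subseteq> carrier B \<Longrightarrow>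
      opr F n f (map (free_gen \<circ> Inl) bs) \<ominus>\<^bsub>ring_of F\<^esub> free_gen (Inl (opr B n f bs)) \<in> coprod_gens B C"
    and "smooth n f \<Longrightarrow> length cs = n \<Longrightarrow> set cs \<subseteq> carrier C \<Longrightarrow>
      opr F n f (map (free_gen \<circ> Inr) cs) \<ominus>\<^bsub>ring_of F\<^esub> free_gen (Inr (opr C n f cs)) \<in> coprod_gens B C"
  unfolding coprod_gens_def Let_def F_def by blast+

lemma coprod_gensE:
  fixes B :: "'b cinf" and C :: "'c cinf"
  defines "F \<equiv> cinf_free (carrier B <+> carrier C)"
  assumes "s \<in> coprod_gens B C"
  obtains
    (left) n f bs where "smooth n f" "length bs = n" "set bs \<subseteq> carrier B"
      "s = opr F n f (map (free_gen \<circ> Inl) bs) \<ominus>\<^bsub>ring_of F\<^esub> free_gen (Inl (opr B n f bs))"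
  | (right) n f cs where "smooth n f" "length cs = n" "set cs \<subseteq> carrier C"
      "s = opr F n f (map (free_gen \<circ> Inr) cs) \<ominus>\<^bsub>ring_of F\<^esub> free_gen (Inr (opr C n f cs))"
  using assms(2) unfolding coprod_gens_def Let_def F_def by blast

context
  fixes B :: "'b cinf" and C :: "'c cinf"
  assumes B: "cinf_ring B" and C: "cinf_ring C"
begin

abbreviation (input) "sum_free \<equiv> cinf_free (carrier B <+> carrier C)"

lemma coprod_gens_parts_closed:
  "smooth n f \<Longrightarrow> length bs = n \<Longrightarrow> set bs \<subseteq> carrier B \<Longrightarrow> opr sum_free n f (map (free_gen \<circ> Inl) bs) \<in> carrier sum_free"
  "smooth n f \<Longrightarrow> length bs = n \<Longrightarrow> set bs \<subseteq> carrier B \<Longrightarrow> free_gen (Inl (opr B n f bs)) \<in> carrier sum_free"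
  "smooth n f \<Longrightarrow> length cs = n \<Longrightarrow> set cs \<subseteq> carrier C \<Longrightarrow> opr sum_free n f (map (free_gen \<circ> Inr) cs) \<in> carrier sum_free"
  "smooth n f \<Longrightarrow> length cs = n \<Longrightarrow> set cs \<subseteq> carrier C \<Longrightarrow> free_gen (Inr (opr C n f cs)) \<in> carrier sum_free"
  by (auto intro!: opr_closed[OF cinf_ring_free] free_gen_closed opr_closed[OF B] opr_closed[OF C])

lemma coprod_gens_closed: "coprod_gens B C \<subseteq> carrier sum_free"
proof
  fix s assume "s \<in> coprod_gens B C"
  then show "s \<in> carrier sum_free"
  proof (cases rule: coprod_gensE)
    case (left n f bs)
    then show ?thesis
      by (simp only: minus_closed_ring_of[OF cinf_ring_free coprod_gens_parts_closed(1,2)])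
  next
    case (right n f cs)
    then show ?thesis
      by (simp only: minus_closed_ring_of[OF cinf_ring_free coprod_gens_parts_closed(3,4)])
  qed
qed

lemma coprod_cover:
  "cinf_cover (\<lambda>_::unit. sum_free) (\<lambda>_ a. coprod_rel B C +>\<^bsub>ring_of sum_free\<^esub> a) (cinf_coprod B C)"
  unfolding cinf_coprod_def coprod_rel_eq
  by (rule quot_cover[OF cinf_ring_free genideal_ideal_ring_of[OF cinf_ring_free coprod_gens_closed]])

lemma cinf_ring_coprod: "cinf_ring (cinf_coprod B C)"
  by (rule cinf_ring_cover[OF coprod_cover])

lemma coprod_inl_hom: "coprod_inl B C \<in> cinf_hom B (cinf_coprod B C)"
proof (rule cinf_homI)
  show "coprod_inl B C b \<in> carrier (cinf_coprod B C)" if "b \<in> carrier B" for b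
    unfolding coprod_inl_def
    by (rule cinf_hom_closed[OF cinf_coverD(2)[OF coprod_cover]]) (use that in \<open>auto intro: free_gen_closed\<close>)
  fix n f bs assume *: "smooth n f" "length bs = n" "set bs \<subseteq> carrier B"
  have "coprod_inl B C (opr B n f bs) = coprod_rel B C +>\<^bsub>ring_of sum_free\<^esub> opr sum_free n f (map (free_gen \<circ> Inl) bs)"
    unfolding coprod_inl_def coprod_rel_eq
    by (rule coset_eq_if_minus_generator[OF cinf_ring_free coprod_gens_closed
          coprod_gens_parts_closed(1,2)[OF *] coprod_gensI(1)[OF *], symmetric])
  also have "\<dots> = opr (cinf_coprod B C) n f (map (\<lambda>a. coprod_rel B C +>\<^bsub>ring_of sum_free\<^esub> a) (map (free_gen \<circ> Inl) bs))"
    by (rule cinf_hom_opr[OF cinf_coverD(2)[OF coprod_cover]]) (use * in \<open>auto intro: free_gen_closed\<close>)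
  finally show "coprod_inl B C (opr B n f bs) = opr (cinf_coprod B C) n f (map (coprod_inl B C) bs)"
    by (simp add: coprod_inl_def[abs_def] comp_def)
qed

lemma coprod_inr_hom: "coprod_inr B C \<in> cinf_hom C (cinf_coprod B C)"
proof (rule cinf_homI)
  show "coprod_inr B C c \<in> carrier (cinf_coprod B C)" if "c \<in> carrier C" for c
    unfolding coprod_inr_def
    by (rule cinf_hom_closed[OF cinf_coverD(2)[OF coprod_cover]]) (use that in \<open>auto intro: free_gen_closed\<close>)
  fix n f cs assume *: "smooth n f" "length cs = n" "set cs \<subseteq> carrier C"
  have "coprod_inr B C (opr C n f cs) = coprod_rel B C +>\<^bsub>ring_of sum_free\<^esub> opr sum_free n f (map (free_gen \<circ> Inr) cs)"
    unfolding coprod_inr_def coprod_rel_eq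
    by (rule coset_eq_if_minus_generator[OF cinf_ring_free coprod_gens_closed
          coprod_gens_parts_closed(3,4)[OF *] coprod_gensI(2)[OF *], symmetric])
  also have "\<dots> = opr (cinf_coprod B C) n f (map (\<lambda>a. coprod_rel B C +>\<^bsub>ring_of sum_free\<^esub> a) (map (free_gen \<circ> Inr) cs))"
    by (rule cinf_hom_opr[OF cinf_coverD(2)[OF coprod_cover]]) (use * in \<open>auto intro: free_gen_closed\<close>)
  finally show "coprod_inr B C (opr C n f cs) = opr (cinf_coprod B C) n f (map (coprod_inr B C) cs)"
    by (simp add: coprod_inr_def[abs_def] comp_def)
qed

lemma coprod_lift:
  assumes V: "cinf_ring V" and h: "h \<in> cinf_hom B V" and k: "k \<in> cinf_hom C V"
  obtains g where "g \<in> cinf_hom (cinf_coprod B C) V"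
    "\<And>b. b \<in> carrier B \<Longrightarrow> g (coprod_inl B C b) = h b"
    "\<And>c. c \<in> carrier C \<Longrightarrow> g (coprod_inr B C c) = k c"
proof -
  have "case_sum h k ` (carrier B <+> carrier C) \<subseteq> carrier V"
    using cinf_hom_closed[OF h] cinf_hom_closed[OF k] by auto
  from cinf_free_lift[OF V this] obtain g0 where g0: "g0 \<in> cinf_hom sum_free V"
    "\<forall>s \<in> carrier B <+> carrier C. g0 (free_gen s) = case_sum h k s" .
  have gl: "g0 (free_gen (Inl b)) = h b" if "b \<in> carrier B" for b using g0(2)[rule_format, of "Inl b"] that by auto
  have gr: "g0 (free_gen (Inr c)) = k c" if "c \<in> carrier C" for c using g0(2)[rule_format, of "Inr c"] that by auto
  have kill: "g0 s = \<zero>\<^bsub>ring_of V\<^esub>" if "s \<in> coprod_gens B C" for s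
    using that
  proof (cases rule: coprod_gensE)
    case (left n f bs)
    note * = left(1-3) and s = left(4)
    have "g0 (opr sum_free n f (map (free_gen \<circ> Inl) bs)) = opr V n f (map g0 (map (free_gen \<circ> Inl) bs))"
      by (rule cinf_hom_opr[OF g0(1) *(1)]) (use * in \<open>auto intro: free_gen_closed\<close>)
    also have "map g0 (map (free_gen \<circ> Inl) bs) = map h bs" using gl *(3) by auto
    also have "opr V n f \<dots> = g0 (free_gen (Inl (opr B n f bs)))"
      by (simp only: gl[OF opr_closed[OF B *]] cinf_hom_opr[OF h *])
    finally show ?thesis
      unfolding s by (rule cinf_hom_minus_eq_zero[OF cinf_ring_free V g0(1) coprod_gens_parts_closed(1,2)[OF *]])
  next
    case (right n f cs)
    note * = right(1-3) and s = right(4)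
    have "g0 (opr sum_free n f (map (free_gen \<circ> Inr) cs)) = opr V n f (map g0 (map (free_gen \<circ> Inr) cs))"
      by (rule cinf_hom_opr[OF g0(1) *(1)]) (use * in \<open>auto intro: free_gen_closed\<close>)
    also have "map g0 (map (free_gen \<circ> Inr) cs) = map k cs" using gr *(3) by auto
    also have "opr V n f \<dots> = g0 (free_gen (Inr (opr C n f cs)))"
      by (simp only: gr[OF opr_closed[OF C *]] cinf_hom_opr[OF k *])
    finally show ?thesis
      unfolding s by (rule cinf_hom_minus_eq_zero[OF cinf_ring_free V g0(1) coprod_gens_parts_closed(3,4)[OF *]])
  qed
  show thesis
  proof (rule quot_lift[OF cinf_ring_free V coprod_gens_closed coprod_rel_eq g0(1) kill])
    fix g assume g: "g \<in> cinf_hom (cinf_quot sum_free (coprod_rel B C)) V"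
      "\<And>a. a \<in> carrier sum_free \<Longrightarrow> g (coprod_rel B C +>\<^bsub>ring_of sum_free\<^esub> a) = g0 a"
    show thesis
    proof (rule that)
      show "g \<in> cinf_hom (cinf_coprod B C) V" using g(1) by (simp only: cinf_coprod_def)
      show "g (coprod_inl B C b) = h b" if "b \<in> carrier B" for b
        unfolding coprod_inl_def using that by (subst g(2)) (auto intro: free_gen_closed simp: gl)
      show "g (coprod_inr B C c) = k c" if "c \<in> carrier C" for c
        unfolding coprod_inr_def using that by (subst g(2)) (auto intro: free_gen_closed simp: gr)
    qed
  qed
qed

lemma coprod_hom_eq:
  assumes g: "g \<in> cinf_hom (cinf_coprod B C) V" and g': "g' \<in> cinf_hom (cinf_coprod B C) V"
    and l: "\<And>b. b \<in> carrier B \<Longrightarrow> g (coprod_inl B C b) = g' (coprod_inl B C b)"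
    and r: "\<And>c. c \<in> carrier C \<Longrightarrow> g (coprod_inr B C c) = g' (coprod_inr B C c)"
    and x: "x \<in> carrier (cinf_coprod B C)"
  shows "g x = g' x"
proof (rule cinf_cover_hom_eq[OF coprod_cover _ x])
  let ?p = "\<lambda>a. coprod_rel B C +>\<^bsub>ring_of sum_free\<^esub> a"
  note p = cinf_coverD(2)[OF coprod_cover]
  fix a assume "a \<in> carrier sum_free"
  then show "g (?p a) = g' (?p a)"
  proof (rule cinf_free_hom_eq[OF cinf_hom_compose[OF p g] cinf_hom_compose[OF p g'], rotated])
    show "g (?p (free_gen s)) = g' (?p (free_gen s))" if "s \<in> carrier B <+> carrier C" for s
      using that l r by (auto simp: coprod_inl_def coprod_inr_def)
  qed
qed

end


section \<open>Adjoining quasi-inverses\<close>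

text \<open>Both \<open>x\<close> and \<open>y\<close> equal \<open>x b y\<close>: insert \<open>b = b y b\<close> into \<open>x = x b x\<close> and \<open>b = b x b\<close> into
\<open>y = y b y\<close>.\<close>

lemma quasi_inverse_unique:
  fixes R (structure)
  assumes R: "cring R" and c: "b \<in> carrier R" "x \<in> carrier R" "y \<in> carrier R"
    and x: "x \<otimes> b \<otimes> x = x" "b \<otimes> x \<otimes> b = b"
    and y: "y \<otimes> b \<otimes> y = y" "b \<otimes> y \<otimes> b = b"
  shows "x = y"
proof -
  interpret cring R by (rule R)
  have "x = x \<otimes> (b \<otimes> y \<otimes> b) \<otimes> x" using x(1) y(2) by simp
  also have "\<dots> = (x \<otimes> b \<otimes> x) \<otimes> (b \<otimes> y)" using c by (simp add: m_ac)
  also have "\<dots> = x \<otimes> (b \<otimes> y)" using x(1) by simp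
  also have "\<dots> = (y \<otimes> b \<otimes> y) \<otimes> (b \<otimes> x)" using c y(1) by (simp add: m_ac)
  also have "\<dots> = y \<otimes> (b \<otimes> x \<otimes> b) \<otimes> y" using c by (simp add: m_ac)
  also have "\<dots> = y" using x(2) y(1) by simp
  finally show ?thesis .
qed

text \<open>If \<open>b = b\<^sup>2 y\<close> then \<open>x = y b y\<close> satisfies both equations.\<close>

lemma vN_regular_quasi_inverse:
  assumes V: "cinf_ring V" and reg: "vN_regular V" and b: "b \<in> carrier V"
  shows "\<exists>x\<in>carrier V. x \<otimes>\<^bsub>ring_of V\<^esub> b \<otimes>\<^bsub>ring_of V\<^esub> x = x \<and> b \<otimes>\<^bsub>ring_of V\<^esub> x \<otimes>\<^bsub>ring_of V\<^esub> b = b"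
proof -
  interpret cring "ring_of V" by (rule cring_ring_of[OF V])
  obtain y where y: "y \<in> carrier V" "b = b [^]\<^bsub>ring_of V\<^esub> (2::nat) \<otimes>\<^bsub>ring_of V\<^esub> y"
    using reg b unfolding vN_regular_def by blast
  have c: "b \<in> carrier (ring_of V)" "y \<in> carrier (ring_of V)" using b y(1) by simp_all
  have e: "b \<otimes>\<^bsub>ring_of V\<^esub> (b \<otimes>\<^bsub>ring_of V\<^esub> y) = b"
    using y(2) c by (simp add: numeral_2_eq_2 m_assoc del: ring_of_carrier)
  define x where "x = y \<otimes>\<^bsub>ring_of V\<^esub> (b \<otimes>\<^bsub>ring_of V\<^esub> y)"
  have x: "x \<in> carrier (ring_of V)" unfolding x_def by (intro m_closed c)
  have "b \<otimes>\<^bsub>ring_of V\<^esub> x \<otimes>\<^bsub>ring_of V\<^esub> b = (b \<otimes>\<^bsub>ring_of V\<^esub> (b \<otimes>\<^bsub>ring_of V\<^esub> y)) \<otimes>\<^bsub>ring_of V\<^esub> (b \<otimes>\<^bsub>ring_of V\<^esub> y)"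
    using c by (simp add: x_def m_ac del: ring_of_carrier)
  also have "\<dots> = b" by (simp only: e)
  finally have bxb: "b \<otimes>\<^bsub>ring_of V\<^esub> x \<otimes>\<^bsub>ring_of V\<^esub> b = b" .
  have "x \<otimes>\<^bsub>ring_of V\<^esub> b \<otimes>\<^bsub>ring_of V\<^esub> x
      = (b \<otimes>\<^bsub>ring_of V\<^esub> x \<otimes>\<^bsub>ring_of V\<^esub> b) \<otimes>\<^bsub>ring_of V\<^esub> (y \<otimes>\<^bsub>ring_of V\<^esub> y)"
  proof -
    have "x \<otimes>\<^bsub>ring_of V\<^esub> b \<otimes>\<^bsub>ring_of V\<^esub> x = x \<otimes>\<^bsub>ring_of V\<^esub> b \<otimes>\<^bsub>ring_of V\<^esub> (y \<otimes>\<^bsub>ring_of V\<^esub> (b \<otimes>\<^bsub>ring_of V\<^esub> y))"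
      by (simp only: x_def)
    also have "\<dots> = (b \<otimes>\<^bsub>ring_of V\<^esub> x \<otimes>\<^bsub>ring_of V\<^esub> b) \<otimes>\<^bsub>ring_of V\<^esub> (y \<otimes>\<^bsub>ring_of V\<^esub> y)"
      using c x by (simp add: m_ac del: ring_of_carrier)
    finally show ?thesis .
  qed
  also have "\<dots> = x"
    unfolding bxb unfolding x_def using c by (simp add: m_ac del: ring_of_carrier)
  finally have "x \<otimes>\<^bsub>ring_of V\<^esub> b \<otimes>\<^bsub>ring_of V\<^esub> x = x" .
  with bxb x show ?thesis by auto
qed

lemma vN_regularI:
  assumes V: "cinf_ring V"
    and q: "\<And>b. b \<in> carrier V \<Longrightarrow> \<exists>x\<in>carrier V. b \<otimes>\<^bsub>ring_of V\<^esub> x \<otimes>\<^bsub>ring_of V\<^esub> b = b"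
  shows "vN_regular V"
  unfolding vN_regular_def
proof
  interpret cring "ring_of V" by (rule cring_ring_of[OF V])
  fix b assume b: "b \<in> carrier V"
  then obtain x where x: "x \<in> carrier V" "b \<otimes>\<^bsub>ring_of V\<^esub> x \<otimes>\<^bsub>ring_of V\<^esub> b = b" using q by blast
  have c: "b \<in> carrier (ring_of V)" "x \<in> carrier (ring_of V)" using b x(1) by simp_all
  have "b [^]\<^bsub>ring_of V\<^esub> (2::nat) \<otimes>\<^bsub>ring_of V\<^esub> x = b \<otimes>\<^bsub>ring_of V\<^esub> x \<otimes>\<^bsub>ring_of V\<^esub> b"
    using c by (simp add: numeral_2_eq_2 m_ac del: ring_of_carrier)
  then show "\<exists>x\<in>carrier V. b = b [^]\<^bsub>ring_of V\<^esub> (2::nat) \<otimes>\<^bsub>ring_of V\<^esub> x"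
    using x by (intro bexI[of _ x]) simp_all
qed

text \<open>The relators that make each \<open>x\<^sub>b\<close> a quasi-inverse of \<open>b\<close>.\<close>

definition plus_gens :: "'b cinf \<Rightarrow> 'b adj set" where
  "plus_gens B =
     (let R = ring_of (adjoin B); \<iota> = adjoin_map B; x = adjoin_var B in
       {(x b \<otimes>\<^bsub>R\<^esub> \<iota> b \<otimes>\<^bsub>R\<^esub> x b) \<ominus>\<^bsub>R\<^esub> x b | b. b \<in> carrier B} \<union>
        {(\<iota> b \<otimes>\<^bsub>R\<^esub> x b \<otimes>\<^bsub>R\<^esub> \<iota> b) \<ominus>\<^bsub>R\<^esub> \<iota> b | b. b \<in> carrier B})"

lemma plus_ideal_eq: "plus_ideal B = genideal (ring_of (adjoin B)) (plus_gens B)"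
  by (simp add: plus_ideal_def plus_gens_def Let_def)

lemma plus_gens_iff:
  "s \<in> plus_gens B \<longleftrightarrow> (\<exists>b\<in>carrier B.
     s = (adjoin_var B b \<otimes>\<^bsub>ring_of (adjoin B)\<^esub> adjoin_map B b \<otimes>\<^bsub>ring_of (adjoin B)\<^esub> adjoin_var B b)
           \<ominus>\<^bsub>ring_of (adjoin B)\<^esub> adjoin_var B b \<or>
     s = (adjoin_map B b \<otimes>\<^bsub>ring_of (adjoin B)\<^esub> adjoin_var B b \<otimes>\<^bsub>ring_of (adjoin B)\<^esub> adjoin_map B b)
           \<ominus>\<^bsub>ring_of (adjoin B)\<^esub> adjoin_map B b)"
  unfolding plus_gens_def Let_def by auto

definition plus_var :: "'b cinf \<Rightarrow> 'b \<Rightarrow> 'b adj set" where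
  "plus_var B b = plus_ideal B +>\<^bsub>ring_of (adjoin B)\<^esub> adjoin_var B b"

context
  fixes B :: "'b cinf"
  assumes B: "cinf_ring B"
begin

lemma cinf_ring_adjoin: "cinf_ring (adjoin B)"
  unfolding adjoin_def by (rule cinf_ring_coprod[OF B cinf_ring_free])

lemma adjoin_map_hom: "adjoin_map B \<in> cinf_hom B (adjoin B)"
  unfolding adjoin_def adjoin_map_def by (rule coprod_inl_hom[OF B cinf_ring_free])

lemma adjoin_var_closed: "b \<in> carrier B \<Longrightarrow> adjoin_var B b \<in> carrier (adjoin B)"
  unfolding adjoin_def adjoin_var_def
  by (rule cinf_hom_closed[OF coprod_inr_hom[OF B cinf_ring_free] free_gen_closed])

lemma adjoin_map_closed: "b \<in> carrier B \<Longrightarrow> adjoin_map B b \<in> carrier (adjoin B)"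
  by (rule cinf_hom_closed[OF adjoin_map_hom])

lemma adjoin_lift:
  assumes V: "cinf_ring V" and f: "f \<in> cinf_hom B V" and q: "q ` carrier B \<subseteq> carrier V"
  obtains g where "g \<in> cinf_hom (adjoin B) V" "\<forall>b\<in>carrier B. g (adjoin_map B b) = f b"
    "\<forall>b\<in>carrier B. g (adjoin_var B b) = q b"
proof -
  obtain k where k: "k \<in> cinf_hom (cinf_free (carrier B)) V" "\<forall>b\<in>carrier B. k (free_gen b) = q b"
    by (rule cinf_free_lift[OF V q])
  show thesis
  proof (rule coprod_lift[OF B cinf_ring_free V f k(1)])
    fix g assume g: "g \<in> cinf_hom (cinf_coprod B (cinf_free (carrier B))) V"
      "\<And>b. b \<in> carrier B \<Longrightarrow> g (coprod_inl B (cinf_free (carrier B)) b) = f b"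
      "\<And>c. c \<in> carrier (cinf_free (carrier B)) \<Longrightarrow> g (coprod_inr B (cinf_free (carrier B)) c) = k c"
    show thesis
      by (rule that[of g])
        (use g k(2) free_gen_closed[of _ "carrier B"] in \<open>simp_all add: adjoin_def adjoin_map_def adjoin_var_def\<close>)
  qed
qed

lemma adjoin_hom_eq:
  assumes g: "g \<in> cinf_hom (adjoin B) V" and g': "g' \<in> cinf_hom (adjoin B) V"
    and l: "\<And>b. b \<in> carrier B \<Longrightarrow> g (adjoin_map B b) = g' (adjoin_map B b)"
    and r: "\<And>b. b \<in> carrier B \<Longrightarrow> g (adjoin_var B b) = g' (adjoin_var B b)"
    and x: "x \<in> carrier (adjoin B)"
  shows "g x = g' x"
proof (rule coprod_hom_eq[OF B cinf_ring_free g[unfolded adjoin_def] g'[unfolded adjoin_def] _ _ x[unfolded adjoin_def]])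
  show "g (coprod_inl B (cinf_free (carrier B)) b) = g' (coprod_inl B (cinf_free (carrier B)) b)"
    if "b \<in> carrier B" for b
    using l[OF that] by (simp add: adjoin_map_def)
  note inr = coprod_inr_hom[OF B cinf_ring_free[of "carrier B"], folded adjoin_def]
  show "g (coprod_inr B (cinf_free (carrier B)) c) = g' (coprod_inr B (cinf_free (carrier B)) c)"
    if "c \<in> carrier (cinf_free (carrier B))" for c
  proof (rule cinf_free_hom_eq[OF cinf_hom_compose[OF inr g] cinf_hom_compose[OF inr g'] _ that])
    show "g (coprod_inr B (cinf_free (carrier B)) (free_gen s)) = g' (coprod_inr B (cinf_free (carrier B)) (free_gen s))"
      if "s \<in> carrier B" for s
      using r[OF that] by (simp add: adjoin_var_def)
  qed
qed

lemma plus_relator_parts_closed: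
  assumes "b \<in> carrier B"
  shows "adjoin_var B b \<otimes>\<^bsub>ring_of (adjoin B)\<^esub> adjoin_map B b \<otimes>\<^bsub>ring_of (adjoin B)\<^esub> adjoin_var B b \<in> carrier (adjoin B)"
    and "adjoin_map B b \<otimes>\<^bsub>ring_of (adjoin B)\<^esub> adjoin_var B b \<otimes>\<^bsub>ring_of (adjoin B)\<^esub> adjoin_map B b \<in> carrier (adjoin B)"
  using assms by (simp_all add: mult_closed_ring_of cinf_ring_adjoin adjoin_var_closed adjoin_map_closed)

lemma plus_gens_closed: "plus_gens B \<subseteq> carrier (adjoin B)"
proof
  fix s assume "s \<in> plus_gens B"
  then show "s \<in> carrier (adjoin B)"
    unfolding plus_gens_iff
    using minus_closed_ring_of[OF cinf_ring_adjoin] plus_relator_parts_closed adjoin_var_closed adjoin_map_closed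
    by (elim bexE disjE) simp_all
qed

lemma plus_cover:
  "cinf_cover (\<lambda>_::unit. adjoin B) (\<lambda>_ a. plus_ideal B +>\<^bsub>ring_of (adjoin B)\<^esub> a) (plus_ring B)"
  unfolding plus_ring_def plus_ideal_eq
  by (rule quot_cover[OF cinf_ring_adjoin genideal_ideal_ring_of[OF cinf_ring_adjoin plus_gens_closed]])

lemma cinf_ring_plus: "cinf_ring (plus_ring B)"
  by (rule cinf_ring_cover[OF plus_cover])

lemma plus_map_hom: "plus_map B \<in> cinf_hom B (plus_ring B)"
  using cinf_hom_compose[OF adjoin_map_hom cinf_coverD(2)[OF plus_cover]]
  by (simp add: plus_map_def[abs_def])

lemma plus_var_closed: "b \<in> carrier B \<Longrightarrow> plus_var B b \<in> carrier (plus_ring B)"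
  unfolding plus_var_def by (rule cinf_hom_closed[OF cinf_coverD(2)[OF plus_cover] adjoin_var_closed])

lemma plus_var_quasi_inverse:
  assumes b: "b \<in> carrier B"
  shows "plus_var B b \<otimes>\<^bsub>ring_of (plus_ring B)\<^esub> plus_map B b \<otimes>\<^bsub>ring_of (plus_ring B)\<^esub> plus_var B b = plus_var B b"
    and "plus_map B b \<otimes>\<^bsub>ring_of (plus_ring B)\<^esub> plus_var B b \<otimes>\<^bsub>ring_of (plus_ring B)\<^esub> plus_map B b = plus_map B b"
proof -
  let ?p = "\<lambda>a. plus_ideal B +>\<^bsub>ring_of (adjoin B)\<^esub> a"
  interpret p: ring_hom_ring "ring_of (adjoin B)" "ring_of (plus_ring B)" ?p
    by (rule ring_hom_ring_cinf_hom[OF cinf_ring_adjoin cinf_ring_plus cinf_coverD(2)[OF plus_cover]])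
  have c: "adjoin_var B b \<in> carrier (ring_of (adjoin B))" "adjoin_map B b \<in> carrier (ring_of (adjoin B))"
    using adjoin_var_closed[OF b] adjoin_map_closed[OF b] by simp_all
  have "?p (adjoin_var B b \<otimes>\<^bsub>ring_of (adjoin B)\<^esub> adjoin_map B b \<otimes>\<^bsub>ring_of (adjoin B)\<^esub> adjoin_var B b) = ?p (adjoin_var B b)"
    unfolding plus_ideal_eq
    by (rule coset_eq_if_minus_generator[OF cinf_ring_adjoin plus_gens_closed
          plus_relator_parts_closed(1)[OF b] adjoin_var_closed[OF b]])
      (use b in \<open>auto simp: plus_gens_iff\<close>)
  then show "plus_var B b \<otimes>\<^bsub>ring_of (plus_ring B)\<^esub> plus_map B b \<otimes>\<^bsub>ring_of (plus_ring B)\<^esub> plus_var B b = plus_var B b"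
    unfolding plus_var_def plus_map_def by (simp only: p.hom_mult c p.R.m_closed)
  have "?p (adjoin_map B b \<otimes>\<^bsub>ring_of (adjoin B)\<^esub> adjoin_var B b \<otimes>\<^bsub>ring_of (adjoin B)\<^esub> adjoin_map B b) = ?p (adjoin_map B b)"
    unfolding plus_ideal_eq
    by (rule coset_eq_if_minus_generator[OF cinf_ring_adjoin plus_gens_closed
          plus_relator_parts_closed(2)[OF b] adjoin_map_closed[OF b]])
      (use b in \<open>auto simp: plus_gens_iff\<close>)
  then show "plus_map B b \<otimes>\<^bsub>ring_of (plus_ring B)\<^esub> plus_var B b \<otimes>\<^bsub>ring_of (plus_ring B)\<^esub> plus_map B b = plus_map B b"
    unfolding plus_var_def plus_map_def by (simp only: p.hom_mult c p.R.m_closed)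
qed

text \<open>Regularity of \<open>V\<close> enters here: send \<open>x\<^sub>b\<close> to a quasi-inverse of \<open>f b\<close>.\<close>

lemma plus_lift:
  assumes V: "cinf_ring V" and reg: "vN_regular V" and f: "f \<in> cinf_hom B V"
  obtains g where "g \<in> cinf_hom (plus_ring B) V" "\<forall>b\<in>carrier B. g (plus_map B b) = f b"
proof -
  have "\<forall>b\<in>carrier B. \<exists>x. x \<in> carrier V \<and>
      x \<otimes>\<^bsub>ring_of V\<^esub> f b \<otimes>\<^bsub>ring_of V\<^esub> x = x \<and> f b \<otimes>\<^bsub>ring_of V\<^esub> x \<otimes>\<^bsub>ring_of V\<^esub> f b = f b"
    using vN_regular_quasi_inverse[OF V reg cinf_hom_closed[OF f]] by blast
  then obtain q where q: "\<forall>b\<in>carrier B. q b \<in> carrier V \<and>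
      q b \<otimes>\<^bsub>ring_of V\<^esub> f b \<otimes>\<^bsub>ring_of V\<^esub> q b = q b \<and> f b \<otimes>\<^bsub>ring_of V\<^esub> q b \<otimes>\<^bsub>ring_of V\<^esub> f b = f b"
    by (rule bchoice[THEN exE])
  then have "q ` carrier B \<subseteq> carrier V" by auto
  then obtain g0 where g0: "g0 \<in> cinf_hom (adjoin B) V" "\<forall>b\<in>carrier B. g0 (adjoin_map B b) = f b"
    "\<forall>b\<in>carrier B. g0 (adjoin_var B b) = q b"
    by (rule adjoin_lift[OF V f])
  interpret g0: ring_hom_ring "ring_of (adjoin B)" "ring_of V" g0
    by (rule ring_hom_ring_cinf_hom[OF cinf_ring_adjoin V g0(1)])
  have kill: "g0 s = \<zero>\<^bsub>ring_of V\<^esub>" if "s \<in> plus_gens B" for s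
  proof -
    from that obtain b where b: "b \<in> carrier B" and
      s: "s = (adjoin_var B b \<otimes>\<^bsub>ring_of (adjoin B)\<^esub> adjoin_map B b \<otimes>\<^bsub>ring_of (adjoin B)\<^esub> adjoin_var B b)
           \<ominus>\<^bsub>ring_of (adjoin B)\<^esub> adjoin_var B b \<or>
     s = (adjoin_map B b \<otimes>\<^bsub>ring_of (adjoin B)\<^esub> adjoin_var B b \<otimes>\<^bsub>ring_of (adjoin B)\<^esub> adjoin_map B b)
           \<ominus>\<^bsub>ring_of (adjoin B)\<^esub> adjoin_map B b"
      unfolding plus_gens_iff by blast
    have c: "adjoin_var B b \<in> carrier (ring_of (adjoin B))" "adjoin_map B b \<in> carrier (ring_of (adjoin B))"
      using adjoin_var_closed[OF b] adjoin_map_closed[OF b] by simp_all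
    note gb = g0(2)[rule_format, OF b] g0(3)[rule_format, OF b] and qb = q[rule_format, OF b]
    have "g0 (adjoin_var B b \<otimes>\<^bsub>ring_of (adjoin B)\<^esub> adjoin_map B b \<otimes>\<^bsub>ring_of (adjoin B)\<^esub> adjoin_var B b)
        = g0 (adjoin_var B b)"
      by (simp only: g0.hom_mult c g0.R.m_closed gb qb)
    moreover have "g0 (adjoin_map B b \<otimes>\<^bsub>ring_of (adjoin B)\<^esub> adjoin_var B b \<otimes>\<^bsub>ring_of (adjoin B)\<^esub> adjoin_map B b)
        = g0 (adjoin_map B b)"
      by (simp only: g0.hom_mult c g0.R.m_closed gb qb)
    ultimately show ?thesis
      using s cinf_hom_minus_eq_zero[OF cinf_ring_adjoin V g0(1)] plus_relator_parts_closed[OF b]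
        adjoin_var_closed[OF b] adjoin_map_closed[OF b] by metis
  qed
  show thesis
  proof (rule quot_lift[OF cinf_ring_adjoin V plus_gens_closed plus_ideal_eq g0(1) kill])
    fix g assume g: "g \<in> cinf_hom (cinf_quot (adjoin B) (plus_ideal B)) V"
      "\<And>a. a \<in> carrier (adjoin B) \<Longrightarrow> g (plus_ideal B +>\<^bsub>ring_of (adjoin B)\<^esub> a) = g0 a"
    show thesis
    proof (rule that)
      show "g \<in> cinf_hom (plus_ring B) V" using g(1) by (simp only: plus_ring_def)
      show "\<forall>b\<in>carrier B. g (plus_map B b) = f b"
        using g(2)[OF adjoin_map_closed] g0(2) by (simp add: plus_map_def)
    qed
  qed
qed

text \<open>Homomorphisms preserve quasi-inverses, so the value at \<open>x\<^sub>b\<close> is the unique quasi-inverse of the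
value at \<open>b\<close>. Thus \<open>B \<rightarrow> B\<^sup>+\<close> is an epimorphism, although it need not be surjective.\<close>

lemma plus_hom_eq:
  assumes V: "cinf_ring V" and g: "g \<in> cinf_hom (plus_ring B) V" and g': "g' \<in> cinf_hom (plus_ring B) V"
    and eq: "\<And>b. b \<in> carrier B \<Longrightarrow> g (plus_map B b) = g' (plus_map B b)"
    and x: "x \<in> carrier (plus_ring B)"
  shows "g x = g' x"
proof -
  let ?p = "\<lambda>a. plus_ideal B +>\<^bsub>ring_of (adjoin B)\<^esub> a"
  note p = cinf_coverD(2)[OF plus_cover]
  have image: "h (plus_map B b) \<in> carrier (ring_of V) \<and> h (plus_var B b) \<in> carrier (ring_of V) \<and>
      h (plus_var B b) \<otimes>\<^bsub>ring_of V\<^esub> h (plus_map B b) \<otimes>\<^bsub>ring_of V\<^esub> h (plus_var B b) = h (plus_var B b) \<and>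
      h (plus_map B b) \<otimes>\<^bsub>ring_of V\<^esub> h (plus_var B b) \<otimes>\<^bsub>ring_of V\<^esub> h (plus_map B b) = h (plus_map B b)"
    if h: "h \<in> cinf_hom (plus_ring B) V" and b: "b \<in> carrier B" for h b
  proof -
    interpret h: ring_hom_ring "ring_of (plus_ring B)" "ring_of V" h
      by (rule ring_hom_ring_cinf_hom[OF cinf_ring_plus V h])
    have c: "plus_var B b \<in> carrier (ring_of (plus_ring B))" "plus_map B b \<in> carrier (ring_of (plus_ring B))"
      using plus_var_closed[OF b] cinf_hom_closed[OF plus_map_hom b] by simp_all
    show ?thesis
      using arg_cong[OF plus_var_quasi_inverse(1)[OF b], of h]
        arg_cong[OF plus_var_quasi_inverse(2)[OF b], of h]
      by (simp only: h.hom_mult c h.R.m_closed h.hom_closed)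
  qed
  have var: "g (plus_var B b) = g' (plus_var B b)" if b: "b \<in> carrier B" for b
    using image[OF g b] image[OF g' b] quasi_inverse_unique[OF cring_ring_of[OF V], of "g (plus_map B b)"]
    unfolding eq[OF b] by blast
  show ?thesis
  proof (rule cinf_cover_hom_eq[OF plus_cover _ x])
    fix a assume "a \<in> carrier (adjoin B)"
    then show "g (?p a) = g' (?p a)"
    proof (rule adjoin_hom_eq[OF cinf_hom_compose[OF p g] cinf_hom_compose[OF p g'], rotated 2])
      show "g (?p (adjoin_map B b)) = g' (?p (adjoin_map B b))" if "b \<in> carrier B" for b
        using eq[OF that] by (simp only: plus_map_def)
      show "g (?p (adjoin_var B b)) = g' (?p (adjoin_var B b))" if "b \<in> carrier B" for b
        using var[OF that] by (simp only: plus_var_def)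
    qed
  qed
qed

end


section \<open>Isomorphic copies\<close>

text \<open>An isomorphism onto the copy is in particular a surjective homomorphism.\<close>

lemma cinf_copy_cover:
  assumes A: "cinf_ring A" and inj: "inj_on h (carrier A)"
  shows "cinf_cover (\<lambda>_::unit. A) (\<lambda>_. h) (cinf_copy h A)"
proof (rule cinf_cover_surj[OF A])
  show "h \<in> cinf_hom A (cinf_copy h A)"
  proof (rule cinf_homI)
    fix n f as assume "smooth n f" "length as = n" and as: "set as \<subseteq> carrier A"
    have "map (inv_into (carrier A) h) (map h as) = as"
      using as inv_into_f_f[OF inj] by (simp add: map_idI subset_iff)
    then show "h (opr A n f as) = opr (cinf_copy h A) n f (map h as)"
      by (simp add: cinf_copy_def del: map_map)
  qed (simp add: cinf_copy_def)
qed (simp add: cinf_copy_def)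

lemma cinf_copy_lift:
  assumes A: "cinf_ring A" and inj: "inj_on h (carrier A)" and f: "f \<in> cinf_hom A V"
  obtains g where "g \<in> cinf_hom (cinf_copy h A) V" "\<forall>a\<in>carrier A. g (h a) = f a"
proof (rule cinf_cover_lift[OF cinf_copy_cover[OF A inj], of "\<lambda>_. f" V])
  show "f \<in> cinf_hom A V" by (rule f)
  show "f a = f b" if "a \<in> carrier A" "b \<in> carrier A" "h a = h b" for a b
    using inj_onD[OF inj that(3,1,2)] by simp
  fix g assume "g \<in> cinf_hom (cinf_copy h A) V" "\<And>(i::unit) a. a \<in> carrier A \<Longrightarrow> g (h a) = f a"
  then show thesis by (intro that[of g]) simp_all
qed


section \<open>Colimits of sequences\<close>

context
  fixes S :: "nat \<Rightarrow> 'a cinf" and t :: "nat \<Rightarrow> 'a \<Rightarrow> 'a"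
  assumes S: "\<And>n. cinf_ring (S n)" and t: "\<And>n. t n \<in> cinf_hom (S n) (S (Suc n))"
begin

lemma seq_map_hom: "seq_map t m d \<in> cinf_hom (S m) (S (m + d))"
proof (induction d)
  case 0
  show ?case by (rule cinf_homI) (simp_all add: map_idI)
next
  case (Suc d)
  show ?case using cinf_hom_compose[OF Suc t[of "m + d"]] by simp
qed

lemma seq_map_closed: "a \<in> carrier (S m) \<Longrightarrow> seq_map t m d a \<in> carrier (S (m + d))"
  by (rule cinf_hom_closed[OF seq_map_hom])

lemma seq_map_add: "seq_map t (m + d) e (seq_map t m d a) = seq_map t m (d + e) a"
  by (induction e) (simp_all add: add.assoc)

lemma equiv_colim_rel: "equiv (SIGMA n:UNIV. carrier (S n)) (colim_rel S t)"
proof (rule equivI)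
  show "colim_rel S t \<subseteq> (SIGMA n:UNIV. carrier (S n)) \<times> (SIGMA n:UNIV. carrier (S n))"
    by (auto simp: colim_rel_def)
  show "refl_on (SIGMA n:UNIV. carrier (S n)) (colim_rel S t)"
    by (auto simp: refl_on_def colim_rel_def)
  show "sym (colim_rel S t)"
    unfolding sym_def colim_rel_def by (auto; metis)
  show "trans (colim_rel S t)"
  proof (rule transI)
    fix x y z assume "(x, y) \<in> colim_rel S t" "(y, z) \<in> colim_rel S t"
    then obtain m a n b k c i j i' j' where xyz: "x = (m, a)" "y = (n, b)" "z = (k, c)"
      and car: "a \<in> carrier (S m)" "b \<in> carrier (S n)" "c \<in> carrier (S k)"
      and e: "m + i = n + j" "seq_map t m i a = seq_map t n j b"
      and e': "n + i' = k + j'" "seq_map t n i' b = seq_map t k j' c"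
      unfolding colim_rel_def by blast
    have "seq_map t m (i + i') a = seq_map t (m + i) i' (seq_map t m i a)" by (simp only: seq_map_add)
    also have "\<dots> = seq_map t n (j + i') b" by (simp only: e seq_map_add)
    also have "\<dots> = seq_map t n (i' + j) b" by (simp only: add.commute)
    also have "\<dots> = seq_map t (n + i') j (seq_map t n i' b)" by (simp only: seq_map_add)
    also have "\<dots> = seq_map t k (j' + j) c" by (simp only: e' seq_map_add)
    finally have "seq_map t m (i + i') a = seq_map t k (j' + j) c" .
    moreover have "m + (i + i') = k + (j' + j)" using e(1) e'(1) by simp
    ultimately show "(x, z) \<in> colim_rel S t"
      using car unfolding xyz colim_rel_def by blast
  qed
qed

lemma colim_map_eq_iff:
  assumes "a \<in> carrier (S m)" "b \<in> carrier (S n)"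
  shows "colim_map S t m a = colim_map S t n b \<longleftrightarrow>
     (\<exists>i j. m + i = n + j \<and> seq_map t m i a = seq_map t n j b)"
proof -
  have "colim_map S t m a = colim_map S t n b \<longleftrightarrow> ((m, a), (n, b)) \<in> colim_rel S t"
    unfolding colim_map_def by (rule eq_equiv_class_iff[OF equiv_colim_rel]) (use assms in auto)
  also have "\<dots> \<longleftrightarrow> (\<exists>i j. m + i = n + j \<and> seq_map t m i a = seq_map t n j b)"
    using assms by (simp add: colim_rel_def)
  finally show ?thesis .
qed

lemma colim_map_seq_map:
  assumes "a \<in> carrier (S m)"
  shows "colim_map S t (m + d) (seq_map t m d a) = colim_map S t m a"
proof -
  have "m + d + 0 = m + d \<and> seq_map t (m + d) 0 (seq_map t m d a) = seq_map t m d a" by simp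
  then show ?thesis
    unfolding colim_map_eq_iff[OF seq_map_closed[OF assms] assms] by blast
qed

lemma colim_map_step: "a \<in> carrier (S n) \<Longrightarrow> colim_map S t (Suc n) (t n a) = colim_map S t n a"
  using colim_map_seq_map[of a n "Suc 0"] by simp

text \<open>Two lists with the same image in the colimit already agree at a later stage: finitely many
identifications, each of which happens at some stage, have a common later stage.\<close>

lemma colim_map_eq_common_stage:
  assumes "set as \<subseteq> carrier (S k)" "set bs \<subseteq> carrier (S l)"
    and "map (colim_map S t k) as = map (colim_map S t l) bs"
  shows "\<exists>i j. k + i = l + j \<and> map (seq_map t k i) as = map (seq_map t l j) bs"
  using map_eq_imp_length_eq[OF assms(3)] assms
proof (induction as bs rule: list_induct2)
  case Nil
  show ?case by (intro exI[of _ l] exI[of _ k]) simp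
next
  case (Cons a as b bs)
  then obtain i j where ij: "k + i = l + j" "map (seq_map t k i) as = map (seq_map t l j) bs" by auto
  from Cons.prems obtain i' j' where ij': "k + i' = l + j'" "seq_map t k i' a = seq_map t l j' b"
    using colim_map_eq_iff[of a k b l] by auto
  have up: "seq_map t k (i + i') c = seq_map t (k + i) i' (seq_map t k i c)"
    "seq_map t l (j + i') c = seq_map t (l + j) i' (seq_map t l j c)" for c
    by (simp_all only: seq_map_add)
  have "map (seq_map t k (i + i')) as = map (seq_map t (k + i) i') (map (seq_map t k i) as)"
    by (simp add: up(1) comp_def)
  also have "\<dots> = map (seq_map t l (j + i')) bs"
    by (simp only: ij) (simp add: up(2) comp_def)
  finally have tail: "map (seq_map t k (i + i')) as = map (seq_map t l (j + i')) bs" .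
  \<comment> \<open>Both elements are pushed further by the other pair of shifts, so that heads and tails meet
      at the same stage.\<close>
  have jj: "j + i' = j' + i" using ij(1) ij'(1) by simp
  have "seq_map t k (i + i') a = seq_map t (k + i') i (seq_map t k i' a)"
    by (simp only: seq_map_add add.commute[of i i'])
  also have "\<dots> = seq_map t l (j' + i) b" by (simp only: ij' seq_map_add)
  finally have "seq_map t k (i + i') a = seq_map t l (j + i') b" by (simp only: jj)
  with tail have "map (seq_map t k (i + i')) (a # as) = map (seq_map t l (j + i')) (b # bs)"
    by simp
  moreover have "k + (i + i') = l + (j + i')" using ij(1) by simp
  ultimately show ?case by blast
qed

text \<open>The union that defines the operation ranges over all lifts of the arguments to some stage; two
lifts become equal at a later stage, so the union is over a single class.\<close>

lemma opr_cinf_colim: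
  assumes f: "smooth n f" and len: "length as = n" and as: "set as \<subseteq> carrier (S k)"
  shows "opr (cinf_colim S t) n f (map (colim_map S t k) as) = colim_map S t k (opr (S k) n f as)"
proof -
  have same: "colim_map S t l (opr (S l) n f bs) = colim_map S t k (opr (S k) n f as)"
    if bs: "set bs \<subseteq> carrier (S l)" and eq: "map (colim_map S t l) bs = map (colim_map S t k) as" for l bs
  proof -
    have len': "length bs = n" using map_eq_imp_length_eq[OF eq] len by simp
    obtain i j where ij: "l + i = k + j" "map (seq_map t l i) bs = map (seq_map t k j) as"
      using colim_map_eq_common_stage[OF bs as eq] by blast
    have "seq_map t l i (opr (S l) n f bs) = opr (S (l + i)) n f (map (seq_map t l i) bs)"
      by (rule cinf_hom_opr[OF seq_map_hom f len' bs])
    also have "\<dots> = seq_map t k j (opr (S k) n f as)"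
      unfolding ij by (rule cinf_hom_opr[OF seq_map_hom f len as, symmetric])
    finally show ?thesis
      using colim_map_eq_iff[OF opr_closed[OF S f len' bs] opr_closed[OF S f len as]] ij(1) by blast
  qed
  have "{colim_map S t l (opr (S l) n f bs) | l bs. set bs \<subseteq> carrier (S l) \<and>
      map (colim_map S t l) bs = map (colim_map S t k) as} = {colim_map S t k (opr (S k) n f as)}"
    (is "?X = {?y}")
  proof
    show "?X \<subseteq> {?y}" using same by blast
    show "{?y} \<subseteq> ?X" using as by blast
  qed
  then show ?thesis by (simp add: cinf_colim_def)
qed

text \<open>Any finite list of elements of the colimit can be pushed forward to one stage.\<close>

lemma colim_cover: "cinf_cover S (colim_map S t) (cinf_colim S t)"
  unfolding cinf_cover_def
proof (intro conjI allI impI)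
  show "cinf_ring (S i)" for i by (rule S)
  show "colim_map S t i \<in> cinf_hom (S i) (cinf_colim S t)" for i
  proof (rule cinf_homI)
    show "colim_map S t i a \<in> carrier (cinf_colim S t)" if "a \<in> carrier (S i)" for a
      using that by (auto simp: cinf_colim_def colim_map_def intro!: quotientI)
  qed (simp add: opr_cinf_colim)
  fix Xs :: "(nat \<times> 'a) set list"
  assume "set Xs \<subseteq> carrier (cinf_colim S t)"
  then show "\<exists>k as. set as \<subseteq> carrier (S k) \<and> Xs = map (colim_map S t k) as"
  proof (induction Xs)
    case (Cons X Xs)
    then obtain k as where as: "set as \<subseteq> carrier (S k)" "Xs = map (colim_map S t k) as" by auto
    have "X \<in> (SIGMA n:UNIV. carrier (S n)) // colim_rel S t"
      using Cons.prems by (simp add: cinf_colim_def)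
    then obtain m a where a: "a \<in> carrier (S m)" "X = colim_map S t m a"
      unfolding colim_map_def by (auto elim!: quotientE)
    let ?as = "seq_map t m k a # map (seq_map t k m) as"
    have "seq_map t k m b \<in> carrier (S (m + k))" if "b \<in> set as" for b
      using seq_map_closed[of b k m] that as(1) by (auto simp: add.commute)
    moreover have "colim_map S t (m + k) (seq_map t k m b) = colim_map S t k b" if "b \<in> set as" for b
      using colim_map_seq_map[of b k m] that as(1) by (auto simp: add.commute)
    ultimately have "set ?as \<subseteq> carrier (S (m + k))" "X # Xs = map (colim_map S t (m + k)) ?as"
      using a as(2) seq_map_closed[OF a(1)] colim_map_seq_map[OF a(1)] by auto
    then show ?case by (intro exI[of _ "m + k"] exI[of _ ?as] conjI)
  qed simp
qed

lemma colim_lift: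
  assumes h: "\<And>n. h n \<in> cinf_hom (S n) V"
    and comm: "\<And>n a. a \<in> carrier (S n) \<Longrightarrow> h (Suc n) (t n a) = h n a"
  obtains g where "g \<in> cinf_hom (cinf_colim S t) V" "\<forall>n. \<forall>a\<in>carrier (S n). g (colim_map S t n a) = h n a"
proof -
  have up: "h (m + d) (seq_map t m d a) = h m a" if "a \<in> carrier (S m)" for m d a
    by (induction d) (simp_all add: comm seq_map_closed that)
  show thesis
  proof (rule cinf_cover_lift[OF colim_cover, of h V, OF h])
    fix m n a b assume ab: "a \<in> carrier (S m)" "b \<in> carrier (S n)" "colim_map S t m a = colim_map S t n b"
    then obtain i j where ij: "m + i = n + j" "seq_map t m i a = seq_map t n j b"
      using colim_map_eq_iff by blast
    have "h m a = h (m + i) (seq_map t m i a)" by (rule up[OF ab(1), symmetric])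
    also have "\<dots> = h n b" unfolding ij by (rule up[OF ab(2)])
    finally show "h m a = h n b" .
  next
    fix g assume "g \<in> cinf_hom (cinf_colim S t) V"
      "\<And>n a. a \<in> carrier (S n) \<Longrightarrow> g (colim_map S t n a) = h n a"
    then show thesis by (intro that[of g]) simp_all
  qed
qed

end


section \<open>The von Neumann regular hull\<close>

context
  fixes A :: "'a cinf"
  assumes A: "cinf_ring A"
begin

lemma inj_Base: "inj_on Base (carrier A)"
  by (simp add: inj_on_def)

lemma cinf_ring_vN_seq: "cinf_ring (vN_seq A n)"
proof (induction n)
  case 0
  show ?case using cinf_ring_cover[OF cinf_copy_cover[OF A inj_Base]] by simp
next
  case (Suc n)
  show ?case using cinf_ring_cover[OF cinf_copy_cover[OF cinf_ring_plus[OF Suc] inj_on_embed]] by simp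
qed

lemma Base_hom: "Base \<in> cinf_hom A (vN_seq A 0)"
  using cinf_coverD(2)[OF cinf_copy_cover[OF A inj_Base]] by simp

lemma embed_hom: "embed (vN_seq A n) \<in> cinf_hom (plus_ring (vN_seq A n)) (vN_seq A (Suc n))"
  using cinf_coverD(2)[OF cinf_copy_cover[OF cinf_ring_plus[OF cinf_ring_vN_seq] inj_on_embed]] by simp

lemma vN_step_hom: "vN_step A n \<in> cinf_hom (vN_seq A n) (vN_seq A (Suc n))"
  using cinf_hom_compose[OF plus_map_hom[OF cinf_ring_vN_seq] embed_hom]
  by (simp add: vN_step_def[abs_def])

lemma A_omega_cover: "cinf_cover (vN_seq A) (colim_map (vN_seq A) (vN_step A)) (A_omega A)"
  unfolding A_omega_def by (rule colim_cover[of "vN_seq A" "vN_step A", OF cinf_ring_vN_seq vN_step_hom])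

lemma cinf_ring_A_omega: "cinf_ring (A_omega A)"
  by (rule cinf_ring_cover[OF A_omega_cover])

lemma nu0_hom: "nu0 A \<in> cinf_hom A (A_omega A)"
  using cinf_hom_compose[OF Base_hom cinf_coverD(2)[OF A_omega_cover]]
  by (simp add: nu0_def[abs_def])

lemma plus_ring_to_A_omega_hom:
  "(\<lambda>p. colim_map (vN_seq A) (vN_step A) (Suc n) (embed (vN_seq A n) p))
     \<in> cinf_hom (plus_ring (vN_seq A n)) (A_omega A)"
  by (rule cinf_hom_compose[OF embed_hom cinf_coverD(2)[OF A_omega_cover]])

lemma colim_map_embed_plus_map:
  assumes "a \<in> carrier (vN_seq A n)"
  shows "colim_map (vN_seq A) (vN_step A) (Suc n) (embed (vN_seq A n) (plus_map (vN_seq A n) a))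
    = colim_map (vN_seq A) (vN_step A) n a"
  using colim_map_step[of "vN_seq A" "vN_step A", OF cinf_ring_vN_seq vN_step_hom assms] by (simp add: vN_step_def)

lemma vN_regular_A_omega: "vN_regular (A_omega A)"
proof (rule vN_regularI[OF cinf_ring_A_omega])
  fix b assume "b \<in> carrier (A_omega A)"
  then obtain n a where a: "a \<in> carrier (vN_seq A n)" and b: "b = colim_map (vN_seq A) (vN_step A) n a"
    by (rule cinf_cover_elemE[OF A_omega_cover])
  let ?B = "vN_seq A n" and ?h = "\<lambda>p. colim_map (vN_seq A) (vN_step A) (Suc n) (embed (vN_seq A n) p)"
  note B = cinf_ring_vN_seq[of n]
  interpret h: ring_hom_ring "ring_of (plus_ring ?B)" "ring_of (A_omega A)" ?h
    by (rule ring_hom_ring_cinf_hom[OF cinf_ring_plus[OF B] cinf_ring_A_omega plus_ring_to_A_omega_hom])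
  have c: "plus_var ?B a \<in> carrier (ring_of (plus_ring ?B))" "plus_map ?B a \<in> carrier (ring_of (plus_ring ?B))"
    using plus_var_closed[OF B a] cinf_hom_closed[OF plus_map_hom[OF B] a] by simp_all
  have b': "b = ?h (plus_map ?B a)"
    by (simp only: b colim_map_embed_plus_map[OF a])
  have "b \<otimes>\<^bsub>ring_of (A_omega A)\<^esub> ?h (plus_var ?B a) \<otimes>\<^bsub>ring_of (A_omega A)\<^esub> b = b"
    using arg_cong[OF plus_var_quasi_inverse(2)[OF B a], of ?h]
    unfolding b' by (simp only: h.hom_mult c h.R.m_closed)
  moreover have "?h (plus_var ?B a) \<in> carrier (A_omega A)"
    using h.hom_closed[OF c(1)] by simp
  ultimately show "\<exists>x\<in>carrier (A_omega A). b \<otimes>\<^bsub>ring_of (A_omega A)\<^esub> x \<otimes>\<^bsub>ring_of (A_omega A)\<^esub> b = b"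
    by blast
qed

text \<open>The extensions to the stages are chosen recursively, each compatible with the previous one. The
invariant of the choice also fixes the value on stage \<open>0\<close>, which \<open>dependent_nat_choice\<close> leaves
open.\<close>

lemma A_omega_lift:
  assumes V: "cinf_ring V" and reg: "vN_regular V" and f: "f \<in> cinf_hom A V"
  obtains g where "g \<in> cinf_hom (A_omega A) V" "\<forall>a\<in>carrier A. g (nu0 A a) = f a"
proof -
  have "\<exists>h. \<forall>n. (h n \<in> cinf_hom (vN_seq A n) V \<and> (n = 0 \<longrightarrow> (\<forall>a\<in>carrier A. h n (Base a) = f a))) \<and>
      (\<forall>a\<in>carrier (vN_seq A n). h (Suc n) (vN_step A n a) = h n a)"
  proof (rule dependent_nat_choice)
    obtain h where "h \<in> cinf_hom (cinf_copy Base A) V" "\<forall>a\<in>carrier A. h (Base a) = f a"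
      by (rule cinf_copy_lift[OF A inj_Base f])
    then show "\<exists>h. h \<in> cinf_hom (vN_seq A 0) V \<and> (0 = (0::nat) \<longrightarrow> (\<forall>a\<in>carrier A. h (Base a) = f a))"
      by auto
  next
    fix h n
    assume "h \<in> cinf_hom (vN_seq A n) V \<and> (n = 0 \<longrightarrow> (\<forall>a\<in>carrier A. h (Base a) = f a))"
    then have h: "h \<in> cinf_hom (vN_seq A n) V" ..
    note B = cinf_ring_vN_seq[of n]
    obtain k where k: "k \<in> cinf_hom (plus_ring (vN_seq A n)) V"
      "\<forall>b\<in>carrier (vN_seq A n). k (plus_map (vN_seq A n) b) = h b"
      by (rule plus_lift[OF B V reg h])
    obtain h' where h': "h' \<in> cinf_hom (cinf_copy (embed (vN_seq A n)) (plus_ring (vN_seq A n))) V"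
      "\<forall>a\<in>carrier (plus_ring (vN_seq A n)). h' (embed (vN_seq A n) a) = k a"
      by (rule cinf_copy_lift[OF cinf_ring_plus[OF B] inj_on_embed k(1)])
    have "h' (vN_step A n a) = h a" if "a \<in> carrier (vN_seq A n)" for a
      using h'(2) k(2) that cinf_hom_closed[OF plus_map_hom[OF B] that] by (simp add: vN_step_def)
    with h'(1) show "\<exists>h'. (h' \<in> cinf_hom (vN_seq A (Suc n)) V \<and>
        (Suc n = 0 \<longrightarrow> (\<forall>a\<in>carrier A. h' (Base a) = f a))) \<and>
        (\<forall>a\<in>carrier (vN_seq A n). h' (vN_step A n a) = h a)"
      by auto
  qed
  then obtain h where h: "\<And>n. h n \<in> cinf_hom (vN_seq A n) V" "\<forall>a\<in>carrier A. h 0 (Base a) = f a"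
    "\<And>n a. a \<in> carrier (vN_seq A n) \<Longrightarrow> h (Suc n) (vN_step A n a) = h n a"
    by blast
  obtain g where g: "g \<in> cinf_hom (cinf_colim (vN_seq A) (vN_step A)) V"
    "\<forall>n. \<forall>a\<in>carrier (vN_seq A n). g (colim_map (vN_seq A) (vN_step A) n a) = h n a"
    by (rule colim_lift[of "vN_seq A" "vN_step A", OF cinf_ring_vN_seq vN_step_hom h(1,3)])
  show thesis
  proof (rule that)
    show "g \<in> cinf_hom (A_omega A) V" using g(1) by (simp only: A_omega_def)
    show "\<forall>a\<in>carrier A. g (nu0 A a) = f a"
      using g(2) h(2) cinf_hom_closed[OF Base_hom] by (simp add: nu0_def)
  qed
qed

text \<open>By induction on the stage, since homomorphisms from \<open>B\<^sup>+\<close> are determined by their values on \<open>B\<close>.\<close>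

lemma A_omega_hom_eq:
  assumes V: "cinf_ring V" and g: "g \<in> cinf_hom (A_omega A) V" and g': "g' \<in> cinf_hom (A_omega A) V"
    and eq: "\<And>a. a \<in> carrier A \<Longrightarrow> g (nu0 A a) = g' (nu0 A a)"
    and x: "x \<in> carrier (A_omega A)"
  shows "g x = g' x"
proof (rule cinf_cover_hom_eq[OF A_omega_cover _ x])
  let ?c = "colim_map (vN_seq A) (vN_step A)"
  show "g (?c n a) = g' (?c n a)" if "a \<in> carrier (vN_seq A n)" for n a
    using that
  proof (induction n arbitrary: a)
    case 0
    then obtain a0 where "a0 \<in> carrier A" "a = Base a0" by (auto simp: cinf_copy_def)
    then show ?case using eq[of a0] by (simp add: nu0_def)
  next
    case (Suc n)
    let ?B = "vN_seq A n"
    obtain p where p: "p \<in> carrier (plus_ring ?B)" "a = embed ?B p"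
      using Suc.prems by (auto simp: cinf_copy_def)
    have "g (?c (Suc n) (embed ?B p)) = g' (?c (Suc n) (embed ?B p))"
    proof (rule plus_hom_eq[OF cinf_ring_vN_seq V cinf_hom_compose[OF plus_ring_to_A_omega_hom g]
          cinf_hom_compose[OF plus_ring_to_A_omega_hom g'] _ p(1)])
      show "g (?c (Suc n) (embed ?B (plus_map ?B b))) = g' (?c (Suc n) (embed ?B (plus_map ?B b)))"
        if "b \<in> carrier ?B" for b
        by (simp only: colim_map_embed_plus_map[OF that] Suc.IH[OF that])
    qed
    then show ?case by (simp only: p(2))
  qed
qed

end

theorem theorem5:
  fixes A :: "'a cinf"
  assumes "cinf_ring A"
  shows "vN_hull TYPE('v) A (A_omega A) (nu0 A)"
  unfolding vN_hull_def
proof (intro conjI allI impI; (elim conjE)?)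
  show "cinf_ring (A_omega A)" by (rule cinf_ring_A_omega[OF assms])
  show "vN_regular (A_omega A)" by (rule vN_regular_A_omega[OF assms])
  show "nu0 A \<in> cinf_hom A (A_omega A)" by (rule nu0_hom[OF assms])
  fix V :: "'v cinf" and f
  assume V: "cinf_ring V" "vN_regular V" and f: "f \<in> cinf_hom A V"
  let ?H = "A_omega A"
  obtain g where g: "g \<in> cinf_hom ?H V" "\<forall>a\<in>carrier A. g (nu0 A a) = f a"
    by (rule A_omega_lift[OF assms V f])
  have closed: "nu0 A a \<in> carrier ?H" if "a \<in> carrier A" for a
    by (rule cinf_hom_closed[OF nu0_hom[OF assms] that])
  show "\<exists>!g. g \<in> cinf_hom ?H V \<inter> extensional (carrier ?H) \<and> (\<forall>a\<in>carrier A. g (nu0 A a) = f a)"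
  \<comment> \<open>Restriction to the carrier selects the extensional representative of \<open>g\<close>.\<close>
  proof (rule ex1I[of _ "restrict g (carrier ?H)"])
    have "restrict g (carrier ?H) \<in> cinf_hom ?H V"
    proof (rule cinf_homI)
      show "restrict g (carrier ?H) x \<in> carrier V" if "x \<in> carrier ?H" for x
        using cinf_hom_closed[OF g(1) that] that by simp
      fix n k xs assume *: "smooth n k" "length xs = n" "set xs \<subseteq> carrier ?H"
      have map_eq: "map (restrict g (carrier ?H)) xs = map g xs" using *(3) by auto
      show "restrict g (carrier ?H) (opr ?H n k xs) = opr V n k (map (restrict g (carrier ?H)) xs)"
        unfolding map_eq
        using opr_closed[OF cinf_ring_A_omega[OF assms] *] cinf_hom_opr[OF g(1) *] by simp
    qed
    then show "restrict g (carrier ?H) \<in> cinf_hom ?H V \<inter> extensional (carrier ?H) \<and>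
        (\<forall>a\<in>carrier A. restrict g (carrier ?H) (nu0 A a) = f a)"
      using g(2) closed by simp
  next
    fix k assume k: "k \<in> cinf_hom ?H V \<inter> extensional (carrier ?H) \<and> (\<forall>a\<in>carrier A. k (nu0 A a) = f a)"
    show "k = restrict g (carrier ?H)"
    proof (rule extensionalityI[of _ "carrier ?H"])
      show "k \<in> extensional (carrier ?H)" using k by blast
      show "restrict g (carrier ?H) \<in> extensional (carrier ?H)" by simp
      fix x assume x: "x \<in> carrier ?H"
      have "k x = g x"
        by (rule A_omega_hom_eq[OF assms V(1) _ g(1) _ x]) (use k g(2) in auto)
      then show "k x = restrict g (carrier ?H) x" using x by simp
    qed
  qed
qed

end
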